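(* Let $A\in\mathbb{R}^{n\times n}$, let $Q\in\mathbb{R}^{n\times n}$ be symmetric, and suppose that the discrete-time Lyapunov equation $AXA'-X+Q=0_{n\times n}$ has at least one solution $X\in\mathbb{R}^{n\times n}$. Let $\mathcal{G}_k$ $(k\ge 0)$ be undirected simple graphs on the node set $\{1,\dots,m\}$ with symmetric doubly stochastic adjacency matrices $\mathcal{A}_k=[a_{ij,k}]$. Suppose the following. (a) For each $i$, $0<\alpha_i<\min\{1,1/\xi_i\}$, where $\xi_i$ is a real number such that $$\|-A_{ri}'T_1-T_2E_{li}'\|_F^2+\|E_{li}T_1+T_2A_{ri}\|_F^2\le \xi_i\|T_1\|_F^2+\xi_i\|T_2\|_F^2\quad\text{for all } T_1\in\mathbb{R}^{n_i\times n},\ T_2\in\mathbb{R}^{n\times n_i}.$$ (b) Only finitely many distinct (weighted) graphs occur in the sequence $\{\mathcal{G}_k\}_{k\ge0}$, and every $\mathcal{G}_k$ is connected. Let $\{\hat Z_k\}_{k\ge0}$ be generated, from an arbitrary initial value $\hat Z_0$, by the distributed algorithm given in the context. Then $\hat Z_k$ converges to an optimal solution $\hat Z^*$ of the optimization problem given in the context at a linear convergence rate, i.e. there are constants $C\ge0$ and $\rho\in(0,1)$ such that $\|\hat Z_k-\hat Z^*\|_F\le C\rho^k$ for all $k\ge0$.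
   Context: $A'$ denotes the transpose of $A$, $\|\cdot\|_F$ the Frobenius norm, $E_n$ the $n\times n$ identity matrix. Decomposition. There are $m$ agents and positive integers $n_1,\dots,n_m$ with $\sum_i n_i=n$. The matrix $A$ is partitioned into row blocks $A_{ri}\in\mathbb{R}^{n_i\times n}$ ($A$ is $A_{r1},\dots,A_{rm}$ stacked vertically). The matrices $Q=[Q_{l1},\dots,Q_{lm}]$ and $E_n=[E_{l1},\dots,E_{lm}]$ are partitioned into column blocks $Q_{li},E_{li}\in\mathbb{R}^{n\times n_i}$. For $Y_i\in\mathbb{R}^{n\times n}$, $Y_i^{ri}\in\mathbb{R}^{n_i\times n}$ denotes the $i$-th row block of $Y_i$ in the same row partition. Optimization problem. For $X_i,Y_i\in\mathbb{R}^{n\times n}$ set $Z_i=\begin{bmatrix}Y_i\\ X_i\end{bmatrix}\in\mathbb{R}^{2n\times n}$ and $$f_i(Z_i)=f_i(X_i,Y_i)=\tfrac12\|Y_i^{ri}-A_{ri}X_i\|_F^2+\tfrac12\|Y_iA_{ri}'-X_iE_{li}+Q_{li}\|_F^2 .$$ Let $\hat Z\in\mathbb{R}^{2mn\times n}$ be $Z_1,\dots,Z_m$ stacked vertically. The problem is: minimize $\sum_{i=1}^m f_i(X_i,Y_i)$ subject to $X_i=X_j$, $Y_i=Y_j$ for all $i,j\in\{1,\dots,m\}$. An optimal solution is written as the corresponding stacked matrix $\hat Z^*$. Graphs. $\mathcal{G}_k$ is the communication graph at time $k$, regarded together with its adjacency matrix; $a_{ij,k}=a_{ji,k}\ge0$,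 $a_{ii,k}=0$, and $a_{ij,k}>0$ exactly when $(i,j)$ is an edge of $\mathcal{G}_k$; $\mathcal{N}_{i,k}$ is the set of neighbors of $i$ in $\mathcal{G}_k$. Algorithm (constant step sizes $\alpha_1,\dots,\alpha_m$). For $k\ge0$ and each $i$, $$X_{i,k+1}=X_{i,k}-\alpha_i d_{X_{i,k}}-\tfrac{\alpha_i}{2}\sum_{j\in\mathcal{N}_{i,k}}a_{ij,k}(X_{i,k}-X_{j,k}),$$ $$Y_{i,k+1}=Y_{i,k}-\alpha_i d_{Y_{i,k}}-\tfrac{\alpha_i}{2}\sum_{j\in\mathcal{N}_{i,k}}a_{ij,k}(Y_{i,k}-Y_{j,k}),$$ where $$d_{X_{i,k}}=-A_{ri}'(Y_{i,k}^{ri}-A_{ri}X_{i,k})-(Y_{i,k}A_{ri}'-X_{i,k}E_{li}+Q_{li})E_{li}',$$ $$d_{Y_{i,k}}=E_{li}(Y_{i,k}^{ri}-A_{ri}X_{i,k})+(Y_{i,k}A_{ri}'-X_{i,k}E_{li}+Q_{li})A_{ri}$$ are the partial gradients of $f_i$ at $(X_{i,k},Y_{i,k})$. Write $Z_{i,k}=\begin{bmatrix}Y_{i,k}\\ X_{i,k}\end{bmatrix}$ and let $\hat Z_k$ be $Z_{1,k},\dots,Z_{m,k}$ stacked vertically. *)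

theory Defs
  imports
    Complex_Main
    "Jordan_Normal_Form.Matrix"
    "Graph_Theory.Digraph_Component"
begin

text \<open>Matrix rows and columns, blocks and agents are all numbered from 0, so the
  agents \<open>1, \<dots>, m\<close> are \<open>{..<m}\<close>, and block \<open>i\<close> of the partition \<open>ns\<close> has size \<open>ns i\<close>.\<close>

definition frob_norm :: "real mat \<Rightarrow> real" where
  "frob_norm M = sqrt (\<Sum>r<dim_row M. \<Sum>c<dim_col M. (M $$ (r, c))\<^sup>2)"

text \<open>The matrix library has no sum over an index set, since the dimensions of the empty sum
  are not determined; here they are arguments.\<close>

definition mat_sum :: "nat \<Rightarrow> nat \<Rightarrow> ('a \<Rightarrow> real mat) \<Rightarrow> 'a set \<Rightarrow> real mat" where
  "mat_sum nr nc F S = mat nr nc (\<lambda>(r, c). \<Sum>s\<in>S. F s $$ (r, c))"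

primrec row_stack :: "nat \<Rightarrow> (nat \<Rightarrow> real mat) \<Rightarrow> nat \<Rightarrow> real mat" where
  "row_stack nc F 0 = 0\<^sub>m 0 nc"
| "row_stack nc F (Suc k) = row_stack nc F k @\<^sub>r F k"

definition block_start :: "(nat \<Rightarrow> nat) \<Rightarrow> nat \<Rightarrow> nat" where
  "block_start ns i = (\<Sum>j<i. ns j)"

definition row_block :: "(nat \<Rightarrow> nat) \<Rightarrow> nat \<Rightarrow> real mat \<Rightarrow> real mat" where
  "row_block ns i M = mat (ns i) (dim_col M) (\<lambda>(r, c). M $$ (block_start ns i + r, c))"

definition col_block :: "(nat \<Rightarrow> nat) \<Rightarrow> nat \<Rightarrow> real mat \<Rightarrow> real mat" where
  "col_block ns i M = mat (dim_row M) (ns i) (\<lambda>(r, c). M $$ (r, block_start ns i + c))"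

abbreviation unit_col_block :: "nat \<Rightarrow> (nat \<Rightarrow> nat) \<Rightarrow> nat \<Rightarrow> real mat" where
  "unit_col_block n ns i \<equiv> col_block ns i (1\<^sub>m n)"

definition row_residual ::
  "(nat \<Rightarrow> nat) \<Rightarrow> real mat \<Rightarrow> nat \<Rightarrow> real mat \<Rightarrow> real mat \<Rightarrow> real mat" where
  "row_residual ns A i X Y = row_block ns i Y - row_block ns i A * X"

definition col_residual ::
  "nat \<Rightarrow> (nat \<Rightarrow> nat) \<Rightarrow> real mat \<Rightarrow> real mat \<Rightarrow> nat \<Rightarrow> real mat \<Rightarrow> real mat \<Rightarrow> real mat" where
  "col_residual n ns A Q i X Y =
     Y * transpose_mat (row_block ns i A) - X * unit_col_block n ns i + col_block ns i Q"

definition local_cost ::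
  "nat \<Rightarrow> (nat \<Rightarrow> nat) \<Rightarrow> real mat \<Rightarrow> real mat \<Rightarrow> nat \<Rightarrow> real mat \<Rightarrow> real mat \<Rightarrow> real" where
  "local_cost n ns A Q i X Y =
     1/2 * (frob_norm (row_residual ns A i X Y))\<^sup>2
     + 1/2 * (frob_norm (col_residual n ns A Q i X Y))\<^sup>2"

definition total_cost ::
  "nat \<Rightarrow> nat \<Rightarrow> (nat \<Rightarrow> nat) \<Rightarrow> real mat \<Rightarrow> real mat
    \<Rightarrow> (nat \<Rightarrow> real mat) \<Rightarrow> (nat \<Rightarrow> real mat) \<Rightarrow> real" where
  "total_cost n m ns A Q X Y = (\<Sum>i<m. local_cost n ns A Q i (X i) (Y i))"

definition feasible :: "nat \<Rightarrow> nat \<Rightarrow> (nat \<Rightarrow> real mat) \<Rightarrow> (nat \<Rightarrow> real mat) \<Rightarrow> bool" where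
  "feasible n m X Y \<longleftrightarrow>
     (\<forall>i<m. X i \<in> carrier_mat n n \<and> Y i \<in> carrier_mat n n) \<and>
     (\<forall>i<m. \<forall>j<m. X i = X j \<and> Y i = Y j)"

definition stacked :: "nat \<Rightarrow> nat \<Rightarrow> (nat \<Rightarrow> real mat) \<Rightarrow> (nat \<Rightarrow> real mat) \<Rightarrow> real mat" where
  "stacked n m X Y = row_stack n (\<lambda>i. Y i @\<^sub>r X i) m"

definition optimal_solution ::
  "nat \<Rightarrow> nat \<Rightarrow> (nat \<Rightarrow> nat) \<Rightarrow> real mat \<Rightarrow> real mat \<Rightarrow> real mat \<Rightarrow> bool" where
  "optimal_solution n m ns A Q Z \<longleftrightarrow>
     (\<exists>X Y. feasible n m X Y \<and> Z = stacked n m X Y \<and>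
        (\<forall>X' Y'. feasible n m X' Y' \<longrightarrow> total_cost n m ns A Q X Y \<le> total_cost n m ns A Q X' Y'))"

definition grad_X ::
  "nat \<Rightarrow> (nat \<Rightarrow> nat) \<Rightarrow> real mat \<Rightarrow> real mat \<Rightarrow> nat \<Rightarrow> real mat \<Rightarrow> real mat \<Rightarrow> real mat" where
  "grad_X n ns A Q i X Y =
     - (transpose_mat (row_block ns i A) * row_residual ns A i X Y)
     - col_residual n ns A Q i X Y * transpose_mat (unit_col_block n ns i)"

definition grad_Y ::
  "nat \<Rightarrow> (nat \<Rightarrow> nat) \<Rightarrow> real mat \<Rightarrow> real mat \<Rightarrow> nat \<Rightarrow> real mat \<Rightarrow> real mat \<Rightarrow> real mat" where
  "grad_Y n ns A Q i X Y =
     unit_col_block n ns i * row_residual ns A i X Y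
     + col_residual n ns A Q i X Y * row_block ns i A"

definition doubly_stochastic :: "nat \<Rightarrow> real mat \<Rightarrow> bool" where
  "doubly_stochastic m W \<longleftrightarrow>
     W \<in> carrier_mat m m \<and>
     (\<forall>i<m. \<forall>j<m. 0 \<le> W $$ (i, j)) \<and>
     (\<forall>i<m. (\<Sum>j<m. W $$ (i, j)) = 1) \<and>
     (\<forall>j<m. (\<Sum>i<m. W $$ (i, j)) = 1)"

text \<open>The locale predicate \<open>pair_graph\<close> describes finite loop-free graphs with a symmetric arc
  relation (and no parallel arcs), that is, simple undirected graphs; an edge between \<open>i\<close> and \<open>j\<close>
  is the pair of arcs \<open>(i, j)\<close> and \<open>(j, i)\<close>.\<close>

definition weighted_graph :: "nat \<Rightarrow> nat pair_pre_digraph \<Rightarrow> real mat \<Rightarrow> bool" where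
  "weighted_graph m G W \<longleftrightarrow>
     pair_graph G \<and> pverts G = {..<m} \<and> W \<in> carrier_mat m m \<and>
     (\<forall>i<m. \<forall>j<m. 0 \<le> W $$ (i, j) \<and> W $$ (i, j) = W $$ (j, i)) \<and>
     (\<forall>i<m. W $$ (i, i) = 0) \<and>
     (\<forall>i<m. \<forall>j<m. 0 < W $$ (i, j) \<longleftrightarrow> (i, j) \<in> parcs G)"

definition neighbors :: "nat pair_pre_digraph \<Rightarrow> nat \<Rightarrow> nat set" where
  "neighbors G i = {j. (i, j) \<in> parcs G}"

definition disagreement ::
  "nat \<Rightarrow> nat pair_pre_digraph \<Rightarrow> real mat \<Rightarrow> (nat \<Rightarrow> real mat) \<Rightarrow> nat \<Rightarrow> real mat" where
  "disagreement n G W X i = mat_sum n n (\<lambda>j. W $$ (i, j) \<cdot>\<^sub>m (X i - X j)) (neighbors G i)"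

text \<open>\<open>X k i\<close> and \<open>Y k i\<close> are the iterates of agent \<open>i\<close> at time \<open>k\<close>.\<close>

definition generated ::
  "nat \<Rightarrow> nat \<Rightarrow> (nat \<Rightarrow> nat) \<Rightarrow> real mat \<Rightarrow> real mat \<Rightarrow> (nat \<Rightarrow> real)
    \<Rightarrow> (nat \<Rightarrow> nat pair_pre_digraph) \<Rightarrow> (nat \<Rightarrow> real mat)
    \<Rightarrow> (nat \<Rightarrow> nat \<Rightarrow> real mat) \<Rightarrow> (nat \<Rightarrow> nat \<Rightarrow> real mat) \<Rightarrow> bool" where
  "generated n m ns A Q \<alpha> G W X Y \<longleftrightarrow>
     (\<forall>i<m. X 0 i \<in> carrier_mat n n \<and> Y 0 i \<in> carrier_mat n n) \<and>
     (\<forall>k. \<forall>i<m.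
        X (Suc k) i = X k i - \<alpha> i \<cdot>\<^sub>m grad_X n ns A Q i (X k i) (Y k i)
                            - (\<alpha> i / 2) \<cdot>\<^sub>m disagreement n (G k) (W k) (X k) i \<and>
        Y (Suc k) i = Y k i - \<alpha> i \<cdot>\<^sub>m grad_Y n ns A Q i (X k i) (Y k i)
                            - (\<alpha> i / 2) \<cdot>\<^sub>m disagreement n (G k) (W k) (Y k) i)"

end

theory Submission
  imports Defs "HOL-Analysis.Convex"
begin

text \<open>A solution of the Lyapunov equation is a common zero of all residuals, so the error \<open>e\<close> relative
  to it obeys the linear recursion \<open>e' = e - D H e\<close> with \<open>D = diag (\<alpha> i)\<close> and
  \<open>H = diag (L i\<^sup>* L i) + (I - W) / 2\<close>, where \<open>L i\<close> is the linear part of the residuals of agent \<open>i\<close>.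
  The operator \<open>D H\<close> is self-adjoint and positive semidefinite for the inner product
  \<open>\<langle>u, v\<rangle> = \<Sum>i. u i \<bullet> v i / \<alpha> i\<close>, the step size conditions keep its spectrum below \<open>2\<close>, and by connectedness
  its kernel consists of the consensual zeros of the \<open>L i\<close>, whatever the graph. Hence the projection
  of \<open>e\<close> onto this kernel is invariant and becomes the limit, while the orthogonal part
  contracts by a factor that is uniform because only finitely many graphs occur.\<close>

section \<open>Weighted inner products and kernels of functionals\<close>

text \<open>Only the values on \<open>T\<close> count, so on functions the form is merely
  semidefinite. The weights leave room for the step sizes, which enter later as
  \<open>1 / \<alpha>\<close>.\<close>

definition wip :: "'t set \<Rightarrow> ('t \<Rightarrow> real) \<Rightarrow> ('t \<Rightarrow> real) \<Rightarrow> ('t \<Rightarrow> real) \<Rightarrow> real" where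
  "wip T w u v = (\<Sum>t\<in>T. w t * u t * v t)"

lemma wip_commute: "wip T w u v = wip T w v u"
  by (simp add: wip_def mult.assoc mult.commute[of "u _"])

lemma wip_diff_left: "wip T w (\<lambda>t. u t - v t) x = wip T w u x - wip T w v x"
  by (simp add: wip_def algebra_simps sum_subtractf)

lemma wip_diff_right: "wip T w x (\<lambda>t. u t - v t) = wip T w x u - wip T w x v"
  by (simp add: wip_def algebra_simps sum_subtractf)

lemma wip_add_left: "wip T w (\<lambda>t. u t + v t) x = wip T w u x + wip T w v x"
  by (simp add: wip_def algebra_simps sum.distrib)

lemma wip_add_right: "wip T w x (\<lambda>t. u t + v t) = wip T w x u + wip T w x v"
  by (simp add: wip_def algebra_simps sum.distrib)

lemma wip_scale_left: "wip T w (\<lambda>t. c * u t) x = c * wip T w u x"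
  by (simp add: wip_def algebra_simps sum_distrib_left)

lemma wip_scale_right: "wip T w x (\<lambda>t. c * u t) = c * wip T w x u"
  by (simp add: wip_def algebra_simps sum_distrib_left)

lemmas wip_linear = wip_diff_left wip_diff_right wip_add_left wip_add_right
  wip_scale_left wip_scale_right

lemma wip_nonneg: "(\<And>t. t \<in> T \<Longrightarrow> 0 \<le> w t) \<Longrightarrow> 0 \<le> wip T w u u"
  unfolding wip_def by (intro sum_nonneg) (simp add: mult.assoc)

text \<open>The square roots of the weights are absorbed into the two vectors.\<close>

lemma wip_Cauchy_Schwarz:
  assumes "\<And>t. t \<in> T \<Longrightarrow> 0 \<le> w t"
  shows "(wip T w u v)\<^sup>2 \<le> wip T w u u * wip T w v v"
proof -
  have *: "wip T w x y = (\<Sum>t\<in>T. (sqrt (w t) * x t) * (sqrt (w t) * y t))" for x y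
    unfolding wip_def
  proof (rule sum.cong[OF refl])
    fix t assume "t \<in> T"
    then have "w t * x t * y t = (sqrt (w t) * sqrt (w t)) * x t * y t"
      using assms by simp
    then show "w t * x t * y t = (sqrt (w t) * x t) * (sqrt (w t) * y t)"
      by (simp only: mult_ac)
  qed
  show ?thesis
    unfolding * using Cauchy_Schwarz_ineq_sum[of "\<lambda>t. sqrt (w t) * u t" "\<lambda>t. sqrt (w t) * v t" T]
    by (simp add: power2_eq_square)
qed

text \<open>By induction on the functionals \<open>\<langle>c j, \<cdot>\<rangle>\<close>: projecting \<open>c j\<close> onto the kernel of the previous ones
  gives the normal direction that the new functional removes, so no compactness or spectral
  theorem is needed.\<close>

lemma ex_projection_onto_kernel:
  fixes T :: "'t set" and c :: "'j \<Rightarrow> 't \<Rightarrow> real"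
  assumes "finite J" and w: "\<And>t. t \<in> T \<Longrightarrow> 0 \<le> w t"
  shows "\<exists>M\<ge>0. \<forall>e. \<exists>u. (\<forall>j\<in>J. wip T w (c j) u = 0)
           \<and> (\<forall>v. (\<forall>j\<in>J. wip T w (c j) v = 0) \<longrightarrow> wip T w (\<lambda>t. e t - u t) v = 0)
           \<and> wip T w (\<lambda>t. e t - u t) (\<lambda>t. e t - u t) \<le> M * (\<Sum>j\<in>J. (wip T w (c j) e)\<^sup>2)"
  using \<open>finite J\<close>
proof (induction J)
  case empty
  show ?case
  proof (intro exI[of _ 0] conjI allI)
    fix e :: "'t \<Rightarrow> real"
    show "\<exists>u. (\<forall>j\<in>{}. wip T w (c j) u = 0)
           \<and> (\<forall>v. (\<forall>j\<in>{}. wip T w (c j) v = 0) \<longrightarrow> wip T w (\<lambda>t. e t - u t) v = 0)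
           \<and> wip T w (\<lambda>t. e t - u t) (\<lambda>t. e t - u t) \<le> 0 * (\<Sum>j\<in>{}. (wip T w (c j) e)\<^sup>2)"
      by (rule exI[of _ e]) (simp add: wip_def)
  qed simp
next
  case (insert j J)
  let ?K = "\<lambda>J u. \<forall>j\<in>J. wip T w (c j) u = 0"
  define S where "S = (\<lambda>e. \<Sum>j\<in>J. (wip T w (c j) e)\<^sup>2)"
  from insert.IH obtain M where M: "M \<ge> 0" and
    proj: "\<And>e. \<exists>u. ?K J u \<and> (\<forall>v. ?K J v \<longrightarrow> wip T w (\<lambda>t. e t - u t) v = 0)
           \<and> wip T w (\<lambda>t. e t - u t) (\<lambda>t. e t - u t) \<le> M * S e"
    unfolding S_def by blast
  have S0: "S e \<ge> 0" for e unfolding S_def by (intro sum_nonneg) auto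
  have Sins: "(\<Sum>j\<in>insert j J. (wip T w (c j) e)\<^sup>2) = (wip T w (c j) e)\<^sup>2 + S e" for e
    unfolding S_def using insert.hyps by simp
  \<comment> \<open>\<open>v\<close> is the projection of \<open>c j\<close> onto the kernel of the
    earlier functionals; there both represent the same functional.\<close>
  obtain v where v: "?K J v" and cv: "\<And>x. ?K J x \<Longrightarrow> wip T w (\<lambda>t. c j t - v t) x = 0"
    using proj[of "c j"] by blast
  have cx: "wip T w (c j) x = wip T w v x" if "?K J x" for x
    using cv[OF that] by (simp add: wip_linear)
  show ?case
  \<comment> \<open>If \<open>v\<close> has norm zero, the new functional vanishes on the earlier
    kernel and the old projection still serves. Otherwise \<open>v\<close> is the direction to be
    removed.\<close>
  proof (cases "wip T w v v = 0")
    case True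
    have "wip T w v x = 0" for x
      using wip_Cauchy_Schwarz[where T=T and w=w and u=v and v=x, OF w] True by simp
    then have KK: "?K (insert j J) x = ?K J x" for x
      using cx by auto
    show ?thesis
      unfolding KK Sins
    proof (intro exI[of _ M] conjI allI M)
      fix e
      show "\<exists>u. ?K J u \<and> (\<forall>v. ?K J v \<longrightarrow> wip T w (\<lambda>t. e t - u t) v = 0)
           \<and> wip T w (\<lambda>t. e t - u t) (\<lambda>t. e t - u t) \<le> M * ((wip T w (c j) e)\<^sup>2 + S e)"
        using proj[of e] M mult_left_mono[of "S e" "(wip T w (c j) e)\<^sup>2 + S e" M]
        by (meson le_add_same_cancel2 order_trans zero_le_power2)
    qed
  next
    case False
    define vv where "vv = wip T w v v"
    define cc where "cc = wip T w (c j) (c j)"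
    have vv: "vv > 0" and cc: "cc \<ge> 0"
      using False wip_nonneg[of T w] w by (auto simp: vv_def cc_def less_le)
    \<comment> \<open>The coefficients of \<open>S e\<close> and of the new square in the final
      estimate, added so that one constant serves both.\<close>
    define M' where "M' = M * (1 + 2 * cc / vv) + 2 / vv"
    have M': "M' \<ge> 0" using M vv cc by (simp add: M'_def)
    show ?thesis
      unfolding Sins
    proof (intro exI[of _ M'] conjI allI M')
      fix e
      obtain u where u: "?K J u" and orth: "\<And>v. ?K J v \<Longrightarrow> wip T w (\<lambda>t. e t - u t) v = 0"
        and bound: "wip T w (\<lambda>t. e t - u t) (\<lambda>t. e t - u t) \<le> M * S e"
        using proj[of e] by blast
      \<comment> \<open>Gram-Schmidt coefficient: subtracting \<open>a * v\<close> makes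
        \<open>u'\<close> orthogonal to \<open>v\<close> and hence annihilated by
        \<open>c j\<close>.\<close>
      define a where "a = wip T w u v / vv"
      define u' where "u' = (\<lambda>t. u t - a * v t)"
      define d where "d = (\<lambda>t. e t - u t)"
      have avv: "a * wip T w v v = wip T w u v" using vv by (simp add: a_def vv_def)
      have Ku': "?K J u'" using u v by (simp add: u'_def wip_linear)
      have "wip T w (c j) u' = 0"
        unfolding cx[OF Ku'] using avv by (simp add: u'_def wip_linear wip_commute[of T w v u])
      with Ku' have 1: "?K (insert j J) u'" by simp
      have eu': "(\<lambda>t. e t - u' t) = (\<lambda>t. d t + a * v t)"
        by (simp add: u'_def d_def fun_eq_iff)
      have 2: "wip T w (\<lambda>t. e t - u' t) x = 0" if "?K (insert j J) x" for x
      proof -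
        from that have x: "?K J x" "wip T w (c j) x = 0" by auto
        then show ?thesis
          unfolding eu' using orth[OF x(1)] cx[OF x(1)] by (simp add: wip_linear d_def)
      qed
      have dv: "wip T w d v = 0" using orth[OF v] by (simp add: d_def)
      have "wip T w (\<lambda>t. e t - u' t) (\<lambda>t. e t - u' t) = wip T w d d + a\<^sup>2 * vv"
        unfolding eu' using dv by (simp add: wip_linear wip_commute[of T w v d] vv_def power2_eq_square)
      also have "a\<^sup>2 * vv = (wip T w u v)\<^sup>2 / vv"
        using vv by (simp add: a_def power2_eq_square)
      \<comment> \<open>On the earlier kernel \<open>v\<close> may be replaced by
        \<open>c j\<close>. This leaves the value at \<open>e\<close>, which the bound admits, and
        the value at \<open>d\<close>, which the induction hypothesis controls.\<close>
      also have "wip T w u v = wip T w (c j) e - wip T w (c j) d"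
        using cx[OF u] by (simp add: d_def wip_linear wip_commute[of T w v u])
      also have "(wip T w (c j) e - wip T w (c j) d)\<^sup>2 \<le> 2 * (wip T w (c j) e)\<^sup>2 + 2 * (wip T w (c j) d)\<^sup>2"
        by (smt (verit) power2_diff power2_sum zero_le_power2)
      also have "(wip T w (c j) d)\<^sup>2 \<le> cc * wip T w d d"
        unfolding cc_def by (rule wip_Cauchy_Schwarz[OF w])
      finally have "wip T w (\<lambda>t. e t - u' t) (\<lambda>t. e t - u' t)
          \<le> wip T w d d + (2 * (wip T w (c j) e)\<^sup>2 + 2 * (cc * wip T w d d)) / vv"
        using vv by (simp add: divide_right_mono)
      also have "\<dots> = wip T w d d * (1 + 2 * cc / vv) + 2 / vv * (wip T w (c j) e)\<^sup>2"
        using vv by (simp add: field_simps)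
      also have "\<dots> \<le> M * S e * (1 + 2 * cc / vv) + 2 / vv * (wip T w (c j) e)\<^sup>2"
        using bound vv cc by (intro add_right_mono mult_right_mono) (auto simp: d_def)
      also have "\<dots> \<le> M' * ((wip T w (c j) e)\<^sup>2 + S e)"
      proof -
        have "0 \<le> M * (1 + 2 * cc / vv) * (wip T w (c j) e)\<^sup>2" "0 \<le> 2 / vv * S e"
          using M vv cc S0 by simp_all
        then show ?thesis unfolding M'_def by (simp add: algebra_simps)
      qed
      finally show "\<exists>u. ?K (insert j J) u \<and> (\<forall>v. ?K (insert j J) v \<longrightarrow> wip T w (\<lambda>t. e t - u t) v = 0)
           \<and> wip T w (\<lambda>t. e t - u t) (\<lambda>t. e t - u t) \<le> M' * ((wip T w (c j) e)\<^sup>2 + S e)"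
        using 1 2 by blast
    qed
  qed
qed

section \<open>Networks of linear least-squares agents\<close>

text \<open>The last clause is connectedness of the graph of positive weights, expressed through
  real functions that are constant along edges: the form needed to compute the kernel.\<close>

definition consensus_weights :: "nat \<Rightarrow> (nat \<Rightarrow> nat \<Rightarrow> real) \<Rightarrow> bool" where
  "consensus_weights m w \<longleftrightarrow>
     (\<forall>i<m. \<forall>j<m. 0 \<le> w i j \<and> w i j = w j i) \<and> (\<forall>i<m. (\<Sum>j<m. w i j) = 1) \<and>
     (\<forall>f :: nat \<Rightarrow> real. (\<forall>i<m. \<forall>j<m. 0 < w i j \<longrightarrow> f i = f j) \<longrightarrow> (\<forall>i<m. \<forall>j<m. f i = f j))"

lemma
  assumes "consensus_weights m w"
  shows consensus_weights_nonneg: "i < m \<Longrightarrow> j < m \<Longrightarrow> 0 \<le> w i j"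
    and consensus_weights_sym: "i < m \<Longrightarrow> j < m \<Longrightarrow> w i j = w j i"
    and consensus_weights_row_sum: "i < m \<Longrightarrow> (\<Sum>j<m. w i j) = 1"
    and consensus_weights_agree:
      "(\<And>i j. i < m \<Longrightarrow> j < m \<Longrightarrow> 0 < w i j \<Longrightarrow> f i = f j) \<Longrightarrow> i < m \<Longrightarrow> j < m \<Longrightarrow> (f i :: real) = f j"
  using assms unfolding consensus_weights_def by blast+

text \<open>Summation by parts for the graph Laplacian: the double sum is averaged with its copy
  under exchange of \<open>i\<close> and \<open>j\<close>, which symmetric weights permit.\<close>

lemma consensus_weights_dirichlet:
  assumes "consensus_weights m w"
  shows "(\<Sum>i<m. \<Sum>j<m. w i j * (f i * (g i - g j)))
         = 1/2 * (\<Sum>i<m. \<Sum>j<m. w i j * ((f i - f j) * (g i - g j)))"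
proof -
  have "(\<Sum>i<m. \<Sum>j<m. w i j * (f i * (g i - g j))) = (\<Sum>j<m. \<Sum>i<m. w i j * (f i * (g i - g j)))"
    by (rule sum.swap)
  also have "\<dots> = (\<Sum>j<m. \<Sum>i<m. w j i * (f i * (g i - g j)))"
    using consensus_weights_sym[OF assms] by (intro sum.cong refl) auto
  finally have "2 * (\<Sum>i<m. \<Sum>j<m. w i j * (f i * (g i - g j)))
      = (\<Sum>i<m. \<Sum>j<m. w i j * (f i * (g i - g j))) + (\<Sum>j<m. \<Sum>i<m. w j i * (f i * (g i - g j)))"
    by simp
  also have "\<dots> = (\<Sum>i<m. \<Sum>j<m. w i j * ((f i - f j) * (g i - g j)))"
    unfolding sum.distrib[symmetric] by (intro sum.cong refl) (simp add: algebra_simps)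
  finally show ?thesis by simp
qed

text \<open>Each row of weights is a probability distribution, so this is Cauchy-Schwarz against the
  constant function 1.\<close>

lemma consensus_weights_jensen:
  assumes "consensus_weights m w" "i < m"
  shows "(\<Sum>j<m. w i j * x j)\<^sup>2 \<le> (\<Sum>j<m. w i j * (x j)\<^sup>2)"
  using wip_Cauchy_Schwarz[where T = "{..<m}" and w = "w i" and u = "\<lambda>_. 1" and v = x]
    consensus_weights_nonneg[OF assms] consensus_weights_row_sum[OF assms]
  by (simp add: wip_def power2_eq_square mult.assoc)

text \<open>Convergence depends only on a linear residual for each agent, its adjoint and a norm
  bound for the adjoint. Linearity is contained in \<open>adjoint\<close>, as \<open>res_eq\<close>
  and \<open>adj_eq\<close> show.\<close>

locale agent_network =
  fixes m :: nat and S :: "'s set" and Ob :: "nat \<Rightarrow> 'o set"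
    and res :: "nat \<Rightarrow> ('s \<Rightarrow> real) \<Rightarrow> 'o \<Rightarrow> real" and adj :: "nat \<Rightarrow> ('o \<Rightarrow> real) \<Rightarrow> 's \<Rightarrow> real"
    and \<alpha> \<xi> :: "nat \<Rightarrow> real"
  assumes finite_S: "finite S" and finite_Ob: "i < m \<Longrightarrow> finite (Ob i)"
    and adjoint: "i < m \<Longrightarrow> (\<Sum>p\<in>Ob i. res i u p * y p) = (\<Sum>s\<in>S. u s * adj i y s)"
    and adj_bound: "i < m \<Longrightarrow> (\<Sum>s\<in>S. (adj i y s)\<^sup>2) \<le> \<xi> i * (\<Sum>p\<in>Ob i. (y p)\<^sup>2)"
    and step_pos: "i < m \<Longrightarrow> 0 < \<alpha> i"
    and step_less: "i < m \<Longrightarrow> \<alpha> i < 1" "i < m \<Longrightarrow> \<alpha> i * \<xi> i < 1"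
begin

section \<open>Error states and the quadratic form that drives the recursion\<close>

abbreviation states :: "(nat \<times> 's) set" where
  "states \<equiv> {..<m} \<times> S"

abbreviation local_state :: "(nat \<times> 's \<Rightarrow> real) \<Rightarrow> nat \<Rightarrow> 's \<Rightarrow> real" where
  "local_state e i \<equiv> (\<lambda>s. e (i, s))"

text \<open>For symmetric weights this is half the gradient of \<open>energy w\<close>.\<close>

definition hess :: "(nat \<Rightarrow> nat \<Rightarrow> real) \<Rightarrow> (nat \<times> 's \<Rightarrow> real) \<Rightarrow> nat \<times> 's \<Rightarrow> real" where
  "hess w e = (\<lambda>(i, s). adj i (res i (local_state e i)) s
                 + 1/2 * (\<Sum>j<m. w i j * (e (i, s) - e (j, s))))"

text \<open>The quadratic form of \<open>hess w\<close>: the factor 1/4 is the 1/2 of the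
  disagreement term, halved again because every pair occurs twice.\<close>

definition energy :: "(nat \<Rightarrow> nat \<Rightarrow> real) \<Rightarrow> (nat \<times> 's \<Rightarrow> real) \<Rightarrow> real" where
  "energy w e = (\<Sum>i<m. \<Sum>p\<in>Ob i. (res i (local_state e i) p)\<^sup>2)
     + 1/4 * (\<Sum>s\<in>S. \<Sum>i<m. \<Sum>j<m. w i j * (e (i, s) - e (j, s))\<^sup>2)"

text \<open>No weights occur here: this is the kernel of \<open>hess w\<close> for every connected
  graph, so one limit can serve all times.\<close>

definition solution :: "(nat \<times> 's \<Rightarrow> real) \<Rightarrow> bool" where
  "solution u \<longleftrightarrow> (\<forall>i<m. \<forall>p\<in>Ob i. res i (local_state u i) p = 0) \<and>
     (\<forall>i<m. \<forall>j<m. \<forall>s\<in>S. u (i, s) = u (j, s))"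

text \<open>The inner product in which the preconditioned operator \<open>\<alpha> \<cdot> hess w\<close> is self-adjoint.\<close>

abbreviation ip :: "(nat \<times> 's \<Rightarrow> real) \<Rightarrow> (nat \<times> 's \<Rightarrow> real) \<Rightarrow> real" where
  "ip \<equiv> wip states (\<lambda>t. 1 / \<alpha> (fst t))"

lemma ip_nonneg: "0 \<le> ip e e"
  by (rule wip_nonneg) (use step_pos in \<open>force intro: less_imp_le\<close>)

lemma ip_sum: "ip u v = (\<Sum>i<m. \<Sum>s\<in>S. 1 / \<alpha> i * u (i, s) * v (i, s))"
  by (simp add: wip_def sum.cartesian_product case_prod_beta)

text \<open>Obtained by testing \<open>adjoint\<close> against the unit vector at \<open>p\<close>;
  \<open>adj_eq\<close> takes the unit vector at \<open>s\<close> instead and shows that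
  \<open>adj i\<close> sees only the values on \<open>Ob i\<close>.\<close>

lemma res_eq:
  assumes "i < m" "p \<in> Ob i"
  shows "res i u p = (\<Sum>s\<in>S. u s * adj i (\<lambda>q. if q = p then 1 else 0) s)"
  using adjoint[OF assms(1), of u "\<lambda>q. if q = p then 1 else 0"] assms finite_Ob
  by (simp add: if_distrib[of "(*) _"] sum.delta cong: if_cong)

lemma adj_eq:
  assumes "i < m" "s \<in> S"
  shows "adj i y s = (\<Sum>p\<in>Ob i. res i (\<lambda>s'. if s' = s then 1 else 0) p * y p)"
  using adjoint[OF assms(1), of "\<lambda>s'. if s' = s then 1 else 0" y] assms finite_S
  by (simp add: if_distrib[of "\<lambda>x. x * _"] sum.delta cong: if_cong)

lemma res_diff:
  assumes "i < m" "p \<in> Ob i"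
  shows "res i (\<lambda>s. u s - v s) p = res i u p - res i v p"
  by (simp add: res_eq[OF assms] left_diff_distrib sum_subtractf)

text \<open>Subtracting a solution alters neither the residuals on \<open>Ob i\<close> nor the
  disagreements, and by \<open>adj_eq\<close> these determine \<open>hess w\<close>.\<close>

lemma hess_diff_solution:
  assumes "solution u" "t \<in> states"
  shows "hess w (\<lambda>t. e t - u t) t = hess w e t"
proof -
  obtain i s where t: "t = (i, s)" and i: "i < m" and s: "s \<in> S"
    using assms(2) by auto
  have "adj i (res i (\<lambda>s. e (i, s) - u (i, s))) s = adj i (res i (local_state e i)) s"
    unfolding adj_eq[OF i s] using assms(1) i
    by (intro sum.cong refl) (simp add: res_diff solution_def)
  moreover have "(\<Sum>j<m. w i j * (e (i, s) - u (i, s) - (e (j, s) - u (j, s))))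
      = (\<Sum>j<m. w i j * (e (i, s) - e (j, s)))"
  proof (rule sum.cong[OF refl])
    fix j assume "j \<in> {..<m}"
    then have "u (i, s) = u (j, s)" using assms(1) i s unfolding solution_def by blast
    then show "w i j * (e (i, s) - u (i, s) - (e (j, s) - u (j, s))) = w i j * (e (i, s) - e (j, s))"
      by simp
  qed
  ultimately show ?thesis by (simp add: hess_def t)
qed

text \<open>Adjointness handles the residual part and summation by parts the Laplacian part. The
  outcome is symmetric in \<open>u\<close> and \<open>e\<close>: \<open>hess w\<close> is
  self-adjoint.\<close>

lemma sum_mult_hess:
  assumes "consensus_weights m w"
  shows "(\<Sum>i<m. \<Sum>s\<in>S. u (i, s) * hess w e (i, s))
    = (\<Sum>i<m. \<Sum>p\<in>Ob i. res i (local_state u i) p * res i (local_state e i) p)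
      + 1/4 * (\<Sum>s\<in>S. \<Sum>i<m. \<Sum>j<m. w i j * ((u (i, s) - u (j, s)) * (e (i, s) - e (j, s))))"
proof -
  have "(\<Sum>i<m. \<Sum>s\<in>S. u (i, s) * hess w e (i, s))
      = (\<Sum>i<m. \<Sum>s\<in>S. u (i, s) * adj i (res i (local_state e i)) s)
        + (\<Sum>i<m. \<Sum>s\<in>S. 1/2 * (\<Sum>j<m. w i j * (u (i, s) * (e (i, s) - e (j, s)))))"
    by (simp add: hess_def distrib_left sum.distrib sum_distrib_left mult_ac)
  also have "(\<Sum>i<m. \<Sum>s\<in>S. u (i, s) * adj i (res i (local_state e i)) s)
      = (\<Sum>i<m. \<Sum>p\<in>Ob i. res i (local_state u i) p * res i (local_state e i) p)"
    by (intro sum.cong refl) (simp add: adjoint)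
  also have "(\<Sum>i<m. \<Sum>s\<in>S. 1/2 * (\<Sum>j<m. w i j * (u (i, s) * (e (i, s) - e (j, s)))))
      = (\<Sum>s\<in>S. 1/2 * (\<Sum>i<m. \<Sum>j<m. w i j * (u (i, s) * (e (i, s) - e (j, s)))))"
    by (subst sum.swap) (simp add: sum_distrib_left)
  also have "\<dots> = 1/4 * (\<Sum>s\<in>S. \<Sum>i<m. \<Sum>j<m. w i j * ((u (i, s) - u (j, s)) * (e (i, s) - e (j, s))))"
    by (subst consensus_weights_dirichlet[OF assms, of "\<lambda>i. u (i, _)" "\<lambda>i. e (i, _)"])
      (simp add: sum_distrib_left)
  finally show ?thesis .
qed

lemma sum_mult_hess_self:
  assumes "consensus_weights m w"
  shows "(\<Sum>i<m. \<Sum>s\<in>S. e (i, s) * hess w e (i, s)) = energy w e"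
  by (simp add: sum_mult_hess[OF assms] energy_def power2_eq_square)

text \<open>The range of a self-adjoint operator is orthogonal to its kernel: each term of the
  symmetric form has a factor that vanishes at a solution.\<close>

lemma sum_mult_hess_solution:
  assumes "consensus_weights m w" "solution u"
  shows "(\<Sum>i<m. \<Sum>s\<in>S. u (i, s) * hess w e (i, s)) = 0"
proof -
  have "(\<Sum>i<m. \<Sum>p\<in>Ob i. res i (local_state u i) p * res i (local_state e i) p) = 0"
    using assms(2) by (intro sum.neutral ballI) (auto simp: solution_def)
  moreover have "(\<Sum>s\<in>S. \<Sum>i<m. \<Sum>j<m. w i j * ((u (i, s) - u (j, s)) * (e (i, s) - e (j, s)))) = 0"
  proof (intro sum.neutral ballI)
    fix s i j assume "s \<in> S" "i \<in> {..<m}" "j \<in> {..<m}"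
    then have "u (i, s) = u (j, s)" using assms(2) unfolding solution_def by blast
    then show "w i j * ((u (i, s) - u (j, s)) * (e (i, s) - e (j, s))) = 0" by simp
  qed
  ultimately show ?thesis by (simp add: sum_mult_hess[OF assms(1)])
qed

section \<open>Estimates for one step of the recursion\<close>

lemma energy_nonneg:
  assumes "consensus_weights m w"
  shows "0 \<le> energy w e"
  unfolding energy_def using consensus_weights_nonneg[OF assms]
  by (intro add_nonneg_nonneg mult_nonneg_nonneg sum_nonneg) auto

text \<open>This bounds the spectrum of \<open>\<alpha> \<cdot> hess w\<close> by \<open>2\<sigma>\<close>; it is here that both step size conditions
  \<open>\<alpha> < 1\<close> and \<open>\<alpha> \<xi> < 1\<close> enter.\<close>

lemma sum_hess_le_energy:
  assumes w: "consensus_weights m w"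
    and \<sigma>: "\<And>i. i < m \<Longrightarrow> \<alpha> i \<le> \<sigma>" "\<And>i. i < m \<Longrightarrow> \<alpha> i * \<xi> i \<le> \<sigma>" "0 \<le> \<sigma>"
  shows "(\<Sum>i<m. \<Sum>s\<in>S. \<alpha> i * (hess w e (i, s))\<^sup>2) \<le> 2 * \<sigma> * energy w e"
proof -
  define g where "g = (\<lambda>i s. adj i (res i (local_state e i)) s)"
  define D where "D = (\<lambda>i s. \<Sum>j<m. w i j * (e (i, s) - e (j, s))\<^sup>2)"
  define R where "R = (\<lambda>i. \<Sum>p\<in>Ob i. (res i (local_state e i) p)\<^sup>2)"
  \<comment> \<open>The equal split of the square fits the weights 1 and 1/4 in
    \<open>energy\<close>: \<open>\<sigma> / 2 * D\<close> is \<open>2 * \<sigma>\<close> times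
    \<open>1/4 * D\<close>, and the gradient part gets the same factor \<open>2 * \<sigma>\<close>
    below.\<close>
  have pointwise: "\<alpha> i * (hess w e (i, s))\<^sup>2 \<le> 2 * (\<alpha> i * (g i s)\<^sup>2) + \<sigma> / 2 * D i s"
    if i: "i < m" and s: "s \<in> S" for i s
  proof -
    define d where "d = (\<Sum>j<m. w i j * (e (i, s) - e (j, s)))"
    have D: "d\<^sup>2 \<le> D i s"
      unfolding d_def D_def by (rule consensus_weights_jensen[OF w i])
    have "(hess w e (i, s))\<^sup>2 = (g i s + 1/2 * d)\<^sup>2"
      by (simp add: hess_def g_def d_def)
    also have "\<dots> \<le> 2 * (g i s)\<^sup>2 + 1/2 * d\<^sup>2"
      using zero_le_power2[of "g i s - 1/2 * d"] by (simp add: power2_eq_square field_simps)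
    finally have "\<alpha> i * (hess w e (i, s))\<^sup>2 \<le> \<alpha> i * (2 * (g i s)\<^sup>2 + 1/2 * d\<^sup>2)"
      using step_pos[OF i] by (simp add: mult_left_mono)
    also have "\<dots> = 2 * (\<alpha> i * (g i s)\<^sup>2) + 1/2 * (\<alpha> i * d\<^sup>2)"
      by (simp add: algebra_simps)
    also have "\<alpha> i * d\<^sup>2 \<le> \<sigma> * D i s"
      using D \<sigma>(1)[OF i] \<sigma>(3) by (intro mult_mono) auto
    finally show ?thesis by simp
  qed
  have "(\<Sum>i<m. \<Sum>s\<in>S. \<alpha> i * (hess w e (i, s))\<^sup>2)
      \<le> (\<Sum>i<m. \<Sum>s\<in>S. 2 * (\<alpha> i * (g i s)\<^sup>2) + \<sigma> / 2 * D i s)"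
    by (intro sum_mono pointwise) auto
  also have "\<dots> = 2 * (\<Sum>i<m. \<alpha> i * (\<Sum>s\<in>S. (g i s)\<^sup>2)) + \<sigma> / 2 * (\<Sum>i<m. \<Sum>s\<in>S. D i s)"
    by (simp add: sum.distrib sum_distrib_left)
  also have "(\<Sum>i<m. \<alpha> i * (\<Sum>s\<in>S. (g i s)\<^sup>2)) \<le> (\<Sum>i<m. \<sigma> * R i)"
  proof (rule sum_mono)
    fix i assume "i \<in> {..<m}"
    then have i: "i < m" by simp
    have "\<alpha> i * (\<Sum>s\<in>S. (g i s)\<^sup>2) \<le> \<alpha> i * (\<xi> i * R i)"
      unfolding g_def R_def using adj_bound[OF i] step_pos[OF i] by (intro mult_left_mono) auto
    also have "\<dots> = (\<alpha> i * \<xi> i) * R i" by simp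
    also have "\<dots> \<le> \<sigma> * R i"
      using \<sigma>(2)[OF i] by (rule mult_right_mono) (simp add: R_def sum_nonneg)
    finally show "\<alpha> i * (\<Sum>s\<in>S. (g i s)\<^sup>2) \<le> \<sigma> * R i" .
  qed
  also have "(\<Sum>i<m. \<Sum>s\<in>S. D i s) = (\<Sum>s\<in>S. \<Sum>i<m. D i s)" by (rule sum.swap)
  finally show ?thesis
    by (simp add: energy_def D_def R_def sum_distrib_left algebra_simps)
qed

text \<open>Expanding the square, \<open>\<alpha>\<close> cancels the weight
  \<open>1 / \<alpha>\<close> in the cross term, which becomes \<open>- 2 * energy\<close>; one
  factor \<open>\<alpha>\<close> survives in the quadratic term, as
  \<open>sum_hess_le_energy\<close> requires.\<close>

lemma descent:
  assumes w: "consensus_weights m w"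
    and \<sigma>: "\<And>i. i < m \<Longrightarrow> \<alpha> i \<le> \<sigma>" "\<And>i. i < m \<Longrightarrow> \<alpha> i * \<xi> i \<le> \<sigma>" "0 \<le> \<sigma>"
    and e': "\<And>i s. i < m \<Longrightarrow> s \<in> S \<Longrightarrow> e' (i, s) = e (i, s) - \<alpha> i * hess w e (i, s)"
  shows "ip e' e' \<le> ip e e - 2 * (1 - \<sigma>) * energy w e"
proof -
  have "ip e' e' = (\<Sum>i<m. \<Sum>s\<in>S. 1 / \<alpha> i * e (i, s) * e (i, s)
      - 2 * (e (i, s) * hess w e (i, s)) + \<alpha> i * (hess w e (i, s))\<^sup>2)"
    unfolding ip_sum
  proof (intro sum.cong refl)
    fix i s assume ins: "i \<in> {..<m}" "s \<in> S"
    then have "\<alpha> i > 0" using step_pos by simp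
    then show "1 / \<alpha> i * e' (i, s) * e' (i, s) = 1 / \<alpha> i * e (i, s) * e (i, s)
      - 2 * (e (i, s) * hess w e (i, s)) + \<alpha> i * (hess w e (i, s))\<^sup>2"
      using ins by (simp add: e' power2_eq_square field_simps)
  qed
  also have "\<dots> = ip e e - 2 * energy w e + (\<Sum>i<m. \<Sum>s\<in>S. \<alpha> i * (hess w e (i, s))\<^sup>2)"
    unfolding ip_sum sum_mult_hess_self[OF w, symmetric]
    by (simp add: sum.distrib sum_subtractf sum_distrib_left)
  also have "\<dots> \<le> ip e e - 2 * energy w e + 2 * \<sigma> * energy w e"
    using sum_hess_le_energy[OF w \<sigma>] by simp
  finally show ?thesis by (simp add: algebra_simps)
qed

text \<open>The weight cancels the step size and the increment pairs to zero with \<open>u\<close>.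
  Hence the component of the error in the kernel never moves.\<close>

lemma ip_solution_invariant:
  assumes w: "consensus_weights m w" and u: "solution u"
    and e': "\<And>i s. i < m \<Longrightarrow> s \<in> S \<Longrightarrow> e' (i, s) = e (i, s) - \<alpha> i * hess w e (i, s)"
  shows "ip e' u = ip e u"
proof -
  have "ip e' u = (\<Sum>i<m. \<Sum>s\<in>S. 1 / \<alpha> i * e (i, s) * u (i, s) - u (i, s) * hess w e (i, s))"
    unfolding ip_sum
  proof (intro sum.cong refl)
    fix i s assume ins: "i \<in> {..<m}" "s \<in> S"
    then have "\<alpha> i > 0" using step_pos by simp
    then show "1 / \<alpha> i * e' (i, s) * u (i, s)
        = 1 / \<alpha> i * e (i, s) * u (i, s) - u (i, s) * hess w e (i, s)"
      using ins by (simp add: e' field_simps)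
  qed
  then show ?thesis
    unfolding ip_sum using sum_mult_hess_solution[OF w u] by (simp add: sum_subtractf)
qed

text \<open>\<open>ex_projection_onto_kernel\<close> for functionals whose common kernel is
  \<open>solution\<close> and whose squares add up to the energy. \<open>M\<close> plays the role of
  a reciprocal spectral gap.\<close>

lemma ex_projection_onto_solutions:
  assumes w: "consensus_weights m w"
  shows "\<exists>M\<ge>0. \<forall>e. \<exists>u. solution u \<and> (\<forall>v. solution v \<longrightarrow> ip (\<lambda>t. e t - u t) v = 0)
           \<and> ip (\<lambda>t. e t - u t) (\<lambda>t. e t - u t) \<le> M * energy w e"
proof -
  \<comment> \<open>The representers, with respect to \<open>ip\<close>, of the residual entries and of
    the weighted disagreements, whose squares add up to the energy.\<close>
  define c where "c = case_sum
    (\<lambda>(i, p) (i', s). if i' = i then \<alpha> i * adj i (\<lambda>q. if q = p then 1 else 0) s else 0)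
    (\<lambda>(s, i, j) t. sqrt (w i j) / 2 *
       ((if t = (i, s) then \<alpha> i else 0) - (if t = (j, s) then \<alpha> j else 0)))"
  let ?JR = "SIGMA i:{..<m}. Ob i" and ?JC = "S \<times> {..<m} \<times> {..<m}"
  have finite: "finite ?JR" "finite ?JC" "finite (?JR <+> ?JC)"
    using finite_S finite_Ob by auto
  have cR: "ip (c (Inl (i, p))) e = res i (local_state e i) p" if "i < m" "p \<in> Ob i" for i p e
  proof -
    have "ip (c (Inl (i, p))) e = (\<Sum>i'<m. if i' = i
        then \<Sum>s\<in>S. e (i, s) * adj i (\<lambda>q. if q = p then 1 else 0) s else 0)"
      unfolding ip_sum using step_pos[OF \<open>i < m\<close>]
      by (intro sum.cong refl) (auto simp: c_def intro!: sum.cong)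
    then show ?thesis using that by (simp add: res_eq)
  qed
  have point: "ip (\<lambda>t. if t = (i, s) then \<alpha> i else 0) e = e (i, s)" if "i < m" "s \<in> S" for i s e
  proof -
    have "ip (\<lambda>t. if t = (i, s) then \<alpha> i else 0) e = (\<Sum>t\<in>states. if t = (i, s) then e t else 0)"
      unfolding wip_def using step_pos[OF \<open>i < m\<close>] by (intro sum.cong refl) auto
    then show ?thesis using that finite_S by simp
  qed
  have cC: "ip (c (Inr (s, i, j))) e = sqrt (w i j) / 2 * (e (i, s) - e (j, s))"
    if "i < m" "j < m" "s \<in> S" for i j s e
    by (simp only: c_def sum.case prod.case wip_scale_left wip_diff_left
        point[OF that(1,3)] point[OF that(2,3)])
  have ker: "(\<forall>j\<in>?JR <+> ?JC. ip (c j) u = 0) \<longleftrightarrow> solution u" for u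
  proof
    assume *: "\<forall>j\<in>?JR <+> ?JC. ip (c j) u = 0"
    have "res i (local_state u i) p = 0" if "i < m" "p \<in> Ob i" for i p
      using bspec[OF * InlI, of "(i, p)"] cR[OF that] that by simp
    moreover have "u (i, s) = u (j, s)" if "i < m" "j < m" "s \<in> S" for i j s
    \<comment> \<open>Only pairs of positive weight give an equation; connectedness extends it to
      all pairs, one coordinate \<open>s\<close> at a time.\<close>
    proof (rule consensus_weights_agree[OF w _ \<open>i < m\<close> \<open>j < m\<close>])
      fix i j assume ij: "i < m" "j < m" "0 < w i j"
      have "ip (c (Inr (s, i, j))) u = 0"
        using ij(1,2) \<open>s \<in> S\<close> by (intro bspec[OF *] InrI) simp
      then have "sqrt (w i j) / 2 * (u (i, s) - u (j, s)) = 0"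
        by (simp only: cC[OF ij(1,2) \<open>s \<in> S\<close>])
      then show "u (i, s) = u (j, s)" using ij(3) by simp
    qed
    ultimately show "solution u" unfolding solution_def by blast
  next
    assume u: "solution u"
    show "\<forall>j\<in>?JR <+> ?JC. ip (c j) u = 0"
    proof
      fix j assume "j \<in> ?JR <+> ?JC"
      then consider i p where "j = Inl (i, p)" "i < m" "p \<in> Ob i"
        | s i i' where "j = Inr (s, i, i')" "i < m" "i' < m" "s \<in> S" by auto
      then show "ip (c j) u = 0"
      proof cases
        case 1
        then show ?thesis using u cR by (simp add: solution_def)
      next
        case 2
        then have "u (i, s) = u (i', s)" using u unfolding solution_def by blast
        then show ?thesis by (simp add: 2(1) cC[OF 2(2,3,4)])
      qed
    qed
  qed
  have sq: "(\<Sum>j\<in>?JR <+> ?JC. (ip (c j) e)\<^sup>2) = energy w e" for e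
  proof -
    have "(\<Sum>j\<in>?JR <+> ?JC. (ip (c j) e)\<^sup>2)
        = (\<Sum>x\<in>?JR. (ip (c (Inl x)) e)\<^sup>2) + (\<Sum>x\<in>?JC. (ip (c (Inr x)) e)\<^sup>2)"
      using finite by (simp add: sum.Plus)
    also have "(\<Sum>x\<in>?JR. (ip (c (Inl x)) e)\<^sup>2) = (\<Sum>(i, p)\<in>?JR. (res i (local_state e i) p)\<^sup>2)"
      by (intro sum.cong refl) (auto simp: cR)
    also have "\<dots> = (\<Sum>i<m. \<Sum>p\<in>Ob i. (res i (local_state e i) p)\<^sup>2)"
      using finite_Ob by (simp add: sum.Sigma)
    also have "(\<Sum>x\<in>?JC. (ip (c (Inr x)) e)\<^sup>2)
        = (\<Sum>(s, i, j)\<in>?JC. 1/4 * (w i j * (e (i, s) - e (j, s))\<^sup>2))"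
    proof (intro sum.cong refl)
      fix x assume "x \<in> ?JC"
      then obtain s i j where x: "x = (s, i, j)" "i < m" "j < m" "s \<in> S" by auto
      show "(ip (c (Inr x)) e)\<^sup>2 = (case x of (s, i, j) \<Rightarrow> 1/4 * (w i j * (e (i, s) - e (j, s))\<^sup>2))"
        using consensus_weights_nonneg[OF w x(2,3)]
        by (simp add: x(1) cC[OF x(2-4)] power_mult_distrib power_divide)
    qed
    also have "\<dots> = (\<Sum>s\<in>S. \<Sum>i<m. \<Sum>j<m. 1/4 * (w i j * (e (i, s) - e (j, s))\<^sup>2))"
      by (simp only: sum.cartesian_product)
    finally show ?thesis by (simp add: energy_def sum_distrib_left)
  qed
  show ?thesis
    using ex_projection_onto_kernel[OF finite(3), of states "\<lambda>t. 1 / \<alpha> (fst t)" c] step_pos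
    unfolding ker sq by (force intro: less_imp_le)
qed

section \<open>Contraction, uniform over the finitely many weight functions\<close>

lemma linear_convergence:
  assumes w: "\<And>k. consensus_weights m (w k)" and fin: "finite (range w)"
    and e: "\<And>k i s. i < m \<Longrightarrow> s \<in> S \<Longrightarrow> e (Suc k) (i, s) = e k (i, s) - \<alpha> i * hess (w k) (e k) (i, s)"
  shows "\<exists>u C \<rho>. solution u \<and> 0 \<le> C \<and> 0 < \<rho> \<and> \<rho> < 1 \<and>
           (\<forall>k. (\<Sum>i<m. \<Sum>s\<in>S. (e k (i, s) - u (i, s))\<^sup>2) \<le> C * \<rho> ^ k)"
proof -
  \<comment> \<open>The inserted 0 keeps the set nonempty and \<open>\<sigma>\<close>
    nonnegative.\<close>
  define \<sigma> where "\<sigma> = Max (insert 0 (\<alpha> ` {..<m} \<union> (\<lambda>i. \<alpha> i * \<xi> i) ` {..<m}))"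
  have \<sigma>: "\<And>i. i < m \<Longrightarrow> \<alpha> i \<le> \<sigma>" "\<And>i. i < m \<Longrightarrow> \<alpha> i * \<xi> i \<le> \<sigma>" "0 \<le> \<sigma>"
    unfolding \<sigma>_def by (auto intro!: Max_ge)
  have \<sigma>1: "\<sigma> < 1"
    unfolding \<sigma>_def using step_less by (subst Max_less_iff) auto
  define proj where "proj = (\<lambda>w M. \<forall>e. \<exists>u. solution u \<and> (\<forall>v. solution v \<longrightarrow> ip (\<lambda>t. e t - u t) v = 0)
           \<and> ip (\<lambda>t. e t - u t) (\<lambda>t. e t - u t) \<le> M * energy w e)"
  have "\<forall>k. \<exists>M\<ge>0. proj (w k) M"
    unfolding proj_def using ex_projection_onto_solutions[OF w] by blast
  then have "\<forall>x\<in>range w. \<exists>M\<ge>0. proj x M" by blast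
  \<comment> \<open>The constant is chosen per weight function rather than per time, so finiteness
    of the range bounds all of them at once.\<close>
  then obtain h where h: "\<And>k. 0 \<le> h (w k)" "\<And>k. proj (w k) (h (w k))"
    by (metis rangeI)
  \<comment> \<open>The inserted 3 keeps \<open>\<rho>\<close> positive, since
    \<open>2 * (1 - \<sigma>) / M\<close> is then at most 2/3.\<close>
  define M where "M = Max (insert 3 (h ` range w))"
  have M3: "3 \<le> M" and hM: "h (w k) \<le> M" for k
    unfolding M_def using fin by (intro Max_ge; simp)+
  \<comment> \<open>The limit is the projection of the initial error.\<close>
  obtain u where u: "solution u" and u_orth: "\<And>v. solution v \<Longrightarrow> ip (\<lambda>t. e 0 t - u t) v = 0"
    using h(2)[of 0] unfolding proj_def by blast
  define f where "f = (\<lambda>k t. e k t - u t)"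
  have f: "f (Suc k) (i, s) = f k (i, s) - \<alpha> i * hess (w k) (f k) (i, s)" if "i < m" "s \<in> S" for k i s
    using that e hess_diff_solution[OF u, of "(i, s)" "w k" "e k"] by (simp add: f_def)
  have orth: "ip (f k) v = 0" if "solution v" for k v
  proof (induction k)
    case 0
    show ?case using u_orth[OF that] by (simp add: f_def)
  next
    case (Suc k)
    then show ?case using ip_solution_invariant[OF w that, of "f (Suc k)" "f k" k] f by simp
  qed
  \<comment> \<open>\<open>f k\<close> stays orthogonal to all solutions, so its projection
    \<open>v\<close> has norm zero and the distance bound becomes a bound on \<open>f k\<close>
    itself.\<close>
  have coercive: "ip (f k) (f k) \<le> M * energy (w k) (f k)" for k
  proof -
    obtain v where v: "solution v" and v_orth: "\<And>x. solution x \<Longrightarrow> ip (\<lambda>t. f k t - v t) x = 0"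
      and bound: "ip (\<lambda>t. f k t - v t) (\<lambda>t. f k t - v t) \<le> h (w k) * energy (w k) (f k)"
      using h(2)[of k] unfolding proj_def by blast
    have "ip v v = 0" "ip (f k) v = 0"
      using v_orth[OF v] orth[OF v] by (simp_all add: wip_diff_left)
    then have "ip (\<lambda>t. f k t - v t) (\<lambda>t. f k t - v t) = ip (f k) (f k)"
      by (simp add: wip_linear wip_commute[of _ _ v "f k"])
    with bound have "ip (f k) (f k) \<le> h (w k) * energy (w k) (f k)" by simp
    also have "\<dots> \<le> M * energy (w k) (f k)"
      using hM energy_nonneg[OF w] by (rule mult_right_mono)
    finally show ?thesis .
  qed
  \<comment> \<open>The factor that results from inserting \<open>coercive\<close> into
    \<open>descent\<close>.\<close>
  define \<rho> where "\<rho> = 1 - 2 * (1 - \<sigma>) / M"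
  have \<rho>: "0 < \<rho>" "\<rho> < 1"
    using M3 \<sigma>1 \<sigma>(3) by (simp_all add: \<rho>_def field_simps)
  have decay: "ip (f k) (f k) \<le> ip (f 0) (f 0) * \<rho> ^ k" for k
  proof (induction k)
    case (Suc k)
    have "ip (f (Suc k)) (f (Suc k)) \<le> ip (f k) (f k) - 2 * (1 - \<sigma>) * energy (w k) (f k)"
      by (rule descent[OF w \<sigma> f])
    also have "\<dots> \<le> ip (f k) (f k) - 2 * (1 - \<sigma>) * (ip (f k) (f k) / M)"
      using coercive[of k] M3 \<sigma>1 by (intro diff_left_mono mult_left_mono) (auto simp: field_simps)
    also have "\<dots> = ip (f k) (f k) * \<rho>"
      by (simp add: \<rho>_def algebra_simps)
    also have "\<dots> \<le> ip (f 0) (f 0) * \<rho> ^ k * \<rho>"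
      using Suc \<rho> by (intro mult_right_mono) auto
    finally show ?case by (simp add: mult_ac)
  qed simp
  \<comment> \<open>Step sizes below 1 make the weights \<open>1 / \<alpha>\<close> at least
    1.\<close>
  have "(\<Sum>i<m. \<Sum>s\<in>S. (e k (i, s) - u (i, s))\<^sup>2) \<le> ip (f k) (f k)" for k
    unfolding ip_sum
  proof (intro sum_mono)
    fix i s assume "i \<in> {..<m}" "s \<in> S"
    then have "1 \<le> 1 / \<alpha> i" using step_pos step_less by (simp add: less_imp_le)
    then have "1 * (f k (i, s))\<^sup>2 \<le> 1 / \<alpha> i * (f k (i, s))\<^sup>2" by (rule mult_right_mono) simp
    then show "(e k (i, s) - u (i, s))\<^sup>2 \<le> 1 / \<alpha> i * f k (i, s) * f k (i, s)"
      by (simp add: f_def power2_eq_square)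
  qed
  then have "(\<Sum>i<m. \<Sum>s\<in>S. (e k (i, s) - u (i, s))\<^sup>2) \<le> ip (f 0) (f 0) * \<rho> ^ k" for k
    using decay order_trans by blast
  then show ?thesis
    using u ip_nonneg \<rho> by blast
qed

end

section \<open>The Frobenius inner product and the residuals\<close>

lemma index_mult_mat_sum:
  assumes "A \<in> carrier_mat a b" "B \<in> carrier_mat b c" "i < a" "j < c"
  shows "(A * B) $$ (i, j) = (\<Sum>l<b. A $$ (i, l) * B $$ (l, j))"
  using assms by (simp add: scalar_prod_def lessThan_atLeast0)

definition frob_inner :: "real mat \<Rightarrow> real mat \<Rightarrow> real" where
  "frob_inner M N = (\<Sum>r<dim_row M. \<Sum>c<dim_col M. M $$ (r, c) * N $$ (r, c))"

lemma frob_inner_carrier: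
  "M \<in> carrier_mat a b \<Longrightarrow> frob_inner M N = (\<Sum>r<a. \<Sum>c<b. M $$ (r, c) * N $$ (r, c))"
  by (auto simp: frob_inner_def)

lemma frob_norm_sq: "(frob_norm M)\<^sup>2 = (\<Sum>r<dim_row M. \<Sum>c<dim_col M. (M $$ (r, c))\<^sup>2)"
  by (simp add: frob_norm_def sum_nonneg)

lemma frob_norm_sq_carrier:
  "M \<in> carrier_mat a b \<Longrightarrow> (frob_norm M)\<^sup>2 = (\<Sum>p\<in>{..<a} \<times> {..<b}. (M $$ p)\<^sup>2)"
  by (auto simp: frob_norm_sq sum.cartesian_product)

lemma frob_norm_zero [simp]: "frob_norm (0\<^sub>m a b) = 0"
  by (simp add: frob_norm_def)

lemma frob_inner_mult_left:
  assumes B: "B \<in> carrier_mat p q" and M: "M \<in> carrier_mat q c" and N: "N \<in> carrier_mat p c"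
  shows "frob_inner (B * M) N = frob_inner M (transpose_mat B * N)"
proof -
  have "frob_inner (B * M) N = (\<Sum>i<p. \<Sum>j<c. \<Sum>l<q. B $$ (i, l) * M $$ (l, j) * N $$ (i, j))"
    using assms by (simp add: frob_inner_carrier[of _ p c] index_mult_mat_sum[OF B M] sum_distrib_right
        del: index_mult_mat(1))
  also have "\<dots> = (\<Sum>j<c. \<Sum>i<p. \<Sum>l<q. B $$ (i, l) * M $$ (l, j) * N $$ (i, j))"
    by (rule sum.swap)
  also have "\<dots> = (\<Sum>j<c. \<Sum>l<q. \<Sum>i<p. B $$ (i, l) * M $$ (l, j) * N $$ (i, j))"
    by (intro sum.cong refl sum.swap)
  also have "\<dots> = (\<Sum>l<q. \<Sum>j<c. \<Sum>i<p. B $$ (i, l) * M $$ (l, j) * N $$ (i, j))"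
    by (rule sum.swap)
  also have "\<dots> = frob_inner M (transpose_mat B * N)"
    using assms by (simp add: frob_inner_carrier[OF M] index_mult_mat_sum[of _ q p N c] sum_distrib_left
        mult_ac del: index_mult_mat(1))
  finally show ?thesis .
qed

lemma frob_inner_transpose:
  assumes "M \<in> carrier_mat a b" "N \<in> carrier_mat a b"
  shows "frob_inner (transpose_mat M) (transpose_mat N) = frob_inner M N"
proof -
  have "frob_inner M N = (\<Sum>c<b. \<Sum>r<a. M $$ (r, c) * N $$ (r, c))"
    unfolding frob_inner_carrier[OF assms(1)] by (rule sum.swap)
  then show ?thesis
    using assms by (simp add: frob_inner_carrier[of _ b a])
qed

text \<open>Transposition preserves the inner product and turns right into left
  multiplication.\<close>

lemma frob_inner_mult_right:
  assumes M: "M \<in> carrier_mat r p" and B: "B \<in> carrier_mat p q" and N: "N \<in> carrier_mat r q"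
  shows "frob_inner (M * B) N = frob_inner M (N * transpose_mat B)"
proof -
  have "frob_inner (M * B) N = frob_inner (transpose_mat (M * B)) (transpose_mat N)"
    using assms by (simp add: frob_inner_transpose[of _ r q])
  also have "\<dots> = frob_inner (transpose_mat B * transpose_mat M) (transpose_mat N)"
    using assms by (simp add: transpose_mult[OF M B])
  also have "\<dots> = frob_inner (transpose_mat M) (B * transpose_mat N)"
    using assms by (subst frob_inner_mult_left[of _ q p _ r]) simp_all
  also have "B * transpose_mat N = transpose_mat (N * transpose_mat B)"
    using assms by (subst transpose_mult[of N r q]) simp_all
  also have "frob_inner (transpose_mat M) \<dots> = frob_inner M (N * transpose_mat B)"
    using assms by (subst frob_inner_transpose[of _ r p]) simp_all
  finally show ?thesis .
qed

lemma
  assumes "M \<in> carrier_mat a b" "N \<in> carrier_mat a b" "K \<in> carrier_mat a b"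
  shows frob_inner_diff_left: "frob_inner (M - N) K = frob_inner M K - frob_inner N K"
    and frob_inner_diff_right: "frob_inner M (N - K) = frob_inner M N - frob_inner M K"
    and frob_inner_add_right: "frob_inner M (N + K) = frob_inner M N + frob_inner M K"
    and frob_inner_uminus_right: "frob_inner M (- N) = - frob_inner M N"
  using assms minus_carrier_mat[OF assms(2), of M]
  by (simp_all add: frob_inner_carrier[of _ a b] algebra_simps sum_subtractf sum.distrib sum_negf)

section \<open>Blocks as products with blocks of the identity\<close>

lemma block_bound:
  assumes "i < m" "(\<Sum>i<m. ns i) = (n :: nat)"
  shows "block_start ns i + ns i \<le> n"
proof -
  have "block_start ns i + ns i = (\<Sum>j<Suc i. ns j)" by (simp add: block_start_def)
  also have "\<dots> \<le> (\<Sum>j<m. ns j)" using assms(1) by (intro sum_mono2) auto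
  finally show ?thesis using assms(2) by simp
qed

lemma row_block_carrier: "M \<in> carrier_mat a b \<Longrightarrow> row_block ns i M \<in> carrier_mat (ns i) b"
  by (simp add: row_block_def)

lemma col_block_carrier: "M \<in> carrier_mat a b \<Longrightarrow> col_block ns i M \<in> carrier_mat a (ns i)"
  by (simp add: col_block_def)

text \<open>As a product, block extraction has a visible adjoint, multiplication by the unit block.
  Row \<open>r\<close> of the factor has its single 1 in column
  \<open>block_start ns i + r\<close>.\<close>

lemma row_block_conv_mult:
  assumes M: "M \<in> carrier_mat n b" and le: "block_start ns i + ns i \<le> n"
  shows "row_block ns i M = transpose_mat (unit_col_block n ns i) * M"
proof (rule eq_matI)
  have E: "transpose_mat (unit_col_block n ns i) \<in> carrier_mat (ns i) n"
    by (simp add: col_block_def)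
  fix r c assume "r < dim_row (transpose_mat (unit_col_block n ns i) * M)"
    "c < dim_col (transpose_mat (unit_col_block n ns i) * M)"
  then have r: "r < ns i" and c: "c < b" using M by (auto simp: col_block_def)
  have "(transpose_mat (unit_col_block n ns i) * M) $$ (r, c)
      = (\<Sum>l<n. if l = block_start ns i + r then M $$ (l, c) else 0)"
    unfolding index_mult_mat_sum[OF E M r c]
    using r le by (intro sum.cong refl) (auto simp: col_block_def)
  also have "\<dots> = row_block ns i M $$ (r, c)"
    using r c le M by (simp add: row_block_def)
  finally show "row_block ns i M $$ (r, c) = (transpose_mat (unit_col_block n ns i) * M) $$ (r, c)" ..
qed (use M in \<open>auto simp: row_block_def col_block_def\<close>)

lemma col_block_conv_mult:
  assumes M: "M \<in> carrier_mat b n" and le: "block_start ns i + ns i \<le> n"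
  shows "col_block ns i M = M * unit_col_block n ns i"
proof (rule eq_matI)
  have E: "unit_col_block n ns i \<in> carrier_mat n (ns i)"
    by (simp add: col_block_def)
  fix r c assume "r < dim_row (M * unit_col_block n ns i)"
    "c < dim_col (M * unit_col_block n ns i)"
  then have r: "r < b" and c: "c < ns i" using M by (auto simp: col_block_def)
  have "(M * unit_col_block n ns i) $$ (r, c)
      = (\<Sum>l<n. if l = block_start ns i + c then M $$ (r, l) else 0)"
    unfolding index_mult_mat_sum[OF M E r c]
    using c le by (intro sum.cong refl) (auto simp: col_block_def)
  also have "\<dots> = col_block ns i M $$ (r, c)"
    using r c le M by (simp add: col_block_def)
  finally show "col_block ns i M $$ (r, c) = (M * unit_col_block n ns i) $$ (r, c)" ..
qed (use M in \<open>auto simp: col_block_def\<close>)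

section \<open>Residuals as affine maps and their zero at a Lyapunov solution\<close>

lemma row_residual_carrier:
  "A \<in> carrier_mat n n \<Longrightarrow> X \<in> carrier_mat n n \<Longrightarrow> row_residual ns A i X Y \<in> carrier_mat (ns i) n"
  by (intro carrier_matI) (auto simp: row_residual_def row_block_def)

lemma col_residual_carrier:
  "Q \<in> carrier_mat n n \<Longrightarrow> col_residual n ns A Q i X Y \<in> carrier_mat n (ns i)"
  by (simp add: col_residual_def col_block_def)

lemma row_residual_add:
  assumes "A \<in> carrier_mat n n" "X \<in> carrier_mat n n" "Y \<in> carrier_mat n n"
    "X' \<in> carrier_mat n n" "Y' \<in> carrier_mat n n" and le: "block_start ns i + ns i \<le> n"
  shows "row_residual ns A i (X + X') (Y + Y') = row_residual ns A i X Y + row_residual ns A i X' Y'"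
proof -
  have "row_block ns i (Y + Y') = row_block ns i Y + row_block ns i Y'"
    using assms by (intro eq_matI) (auto simp: row_block_def)
  moreover have "row_block ns i A * (X + X') = row_block ns i A * X + row_block ns i A * X'"
    using assms row_block_carrier by (intro mult_add_distrib_mat)
  ultimately show ?thesis
    using assms by (intro eq_matI) (auto simp: row_residual_def row_block_def simp del: index_mult_mat(1))
qed

text \<open>The column residual is affine in the pair of matrices; its linear part is the same
  expression with zero in place of \<open>Q\<close>.\<close>

lemma col_residual_add:
  assumes "A \<in> carrier_mat n n" "Q \<in> carrier_mat n n" "X \<in> carrier_mat n n" "Y \<in> carrier_mat n n"
    "X' \<in> carrier_mat n n" "Y' \<in> carrier_mat n n" and le: "block_start ns i + ns i \<le> n"
  shows "col_residual n ns A Q i (X + X') (Y + Y')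
    = col_residual n ns A Q i X Y + col_residual n ns A (0\<^sub>m n n) i X' Y'"
proof -
  let ?B = "transpose_mat (row_block ns i A)" and ?E = "unit_col_block n ns i"
  have B: "?B \<in> carrier_mat n (ns i)" and E: "?E \<in> carrier_mat n (ns i)"
    using assms by (auto simp: row_block_def col_block_def)
  have eq: "(Y + Y') * ?B = Y * ?B + Y' * ?B" "(X + X') * ?E = X * ?E + X' * ?E"
    using assms B E by (simp_all add: add_mult_distrib_mat[of _ n n])
  have Z: "col_block ns i (0\<^sub>m n n) = (0\<^sub>m n (ns i) :: real mat)"
    using le by (intro eq_matI) (auto simp: col_block_def)
  show ?thesis
    unfolding col_residual_def eq Z
  proof (rule eq_matI)
    fix r c
    assume "r < dim_row (Y * ?B - X * ?E + col_block ns i Q + (Y' * ?B - X' * ?E + 0\<^sub>m n (ns i)))"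
      "c < dim_col (Y * ?B - X * ?E + col_block ns i Q + (Y' * ?B - X' * ?E + 0\<^sub>m n (ns i)))"
    then have "r < n" "c < ns i" by auto
    then show "(Y * ?B + Y' * ?B - (X * ?E + X' * ?E) + col_block ns i Q) $$ (r, c)
      = (Y * ?B - X * ?E + col_block ns i Q + (Y' * ?B - X' * ?E + 0\<^sub>m n (ns i))) $$ (r, c)"
      using assms(1-6) B E col_block_carrier[OF assms(2), of ns i]
      by (auto simp del: index_mult_mat(1) col_transpose)
  qed (use assms(2) in \<open>auto simp: col_block_def\<close>)
qed

lemma row_residual_lyapunov_solution:
  assumes "A \<in> carrier_mat n n" "X \<in> carrier_mat n n" and le: "block_start ns i + ns i \<le> n"
  shows "row_residual ns A i X (A * X) = 0\<^sub>m (ns i) n"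
proof -
  have "row_block ns i (A * X) = transpose_mat (unit_col_block n ns i) * (A * X)"
    using assms by (intro row_block_conv_mult) auto
  also have "\<dots> = row_block ns i A * X"
    using assms col_block_carrier[OF one_carrier_mat[of n], of ns i]
      assoc_mult_mat[of "transpose_mat (unit_col_block n ns i)" "ns i" n A n X n]
    by (simp add: row_block_conv_mult[of A n n])
  finally show ?thesis
    using mult_carrier_mat[OF row_block_carrier[OF assms(1)] assms(2)]
    by (simp add: row_residual_def)
qed

text \<open>The transposed row block is \<open>transpose_mat A * ?E\<close>, so the residual is the
  left side of the Lyapunov equation multiplied by \<open>?E\<close> from the right.\<close>

lemma col_residual_lyapunov_solution:
  assumes A: "A \<in> carrier_mat n n" and X: "X \<in> carrier_mat n n" and Q: "Q \<in> carrier_mat n n"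
    and le: "block_start ns i + ns i \<le> n"
    and sol: "A * X * transpose_mat A - X + Q = 0\<^sub>m n n"
  shows "col_residual n ns A Q i X (A * X) = 0\<^sub>m n (ns i)"
proof -
  let ?E = "unit_col_block n ns i"
  have E: "?E \<in> carrier_mat n (ns i)" by (simp add: col_block_def)
  have "transpose_mat (row_block ns i A) = transpose_mat A * ?E"
    using A E by (simp add: row_block_conv_mult[OF A le] transpose_mult[of _ "ns i" n])
  then have "A * X * transpose_mat (row_block ns i A) = A * X * transpose_mat A * ?E"
    using A X E assoc_mult_mat[of "A * X" n n "transpose_mat A" n ?E "ns i"] by simp
  then have "col_residual n ns A Q i X (A * X) = (A * X * transpose_mat A - X + Q) * ?E"
    using A X Q E minus_carrier_mat[OF X, of "A * X * transpose_mat A"]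
    by (simp add: col_residual_def col_block_conv_mult[OF Q le]
        add_mult_distrib_mat[of _ n n] minus_mult_distrib_mat[of _ n n])
  then show ?thesis using E by (simp add: sol)
qed

text \<open>The pair \<open>(Y, X)\<close> and the pair of residuals are flattened to functions on index pairs, with
  \<open>Inl\<close> marking the entries of the first component and \<open>Inr\<close> those of the second.\<close>

type_synonym entry = "(nat \<times> nat) + (nat \<times> nat)"

definition square_entries :: "nat \<Rightarrow> entry set" where
  "square_entries n = ({..<n} \<times> {..<n}) <+> ({..<n} \<times> {..<n})"

definition residual_entries :: "nat \<Rightarrow> (nat \<Rightarrow> nat) \<Rightarrow> nat \<Rightarrow> entry set" where
  "residual_entries n ns i = ({..<ns i} \<times> {..<n}) <+> ({..<n} \<times> {..<ns i})"

definition residual_map ::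
  "nat \<Rightarrow> (nat \<Rightarrow> nat) \<Rightarrow> real mat \<Rightarrow> nat \<Rightarrow> (entry \<Rightarrow> real) \<Rightarrow> entry \<Rightarrow> real" where
  "residual_map n ns A i u = (let Y = mat n n (u \<circ> Inl); X = mat n n (u \<circ> Inr) in
     case_sum (($$) (row_residual ns A i X Y)) (($$) (col_residual n ns A (0\<^sub>m n n) i X Y)))"

definition residual_adjoint ::
  "nat \<Rightarrow> (nat \<Rightarrow> nat) \<Rightarrow> real mat \<Rightarrow> nat \<Rightarrow> (entry \<Rightarrow> real) \<Rightarrow> entry \<Rightarrow> real" where
  "residual_adjoint n ns A i y =
     (let T1 = mat (ns i) n (y \<circ> Inl); T2 = mat n (ns i) (y \<circ> Inr) in
     case_sum (($$) (unit_col_block n ns i * T1 + T2 * row_block ns i A))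
       (($$) (- (transpose_mat (row_block ns i A) * T1) - T2 * transpose_mat (unit_col_block n ns i))))"

lemma finite_entries: "finite (square_entries n)" "finite (residual_entries n ns i)"
  by (simp_all add: square_entries_def residual_entries_def)

lemma sum_index_pairs: "(\<Sum>p\<in>{..<a :: nat} \<times> {..<b :: nat}. f p) = (\<Sum>r<a. \<Sum>c<b. f (r, c))"
  by (simp add: sum.cartesian_product)

text \<open>Both residuals are rewritten with one-sided multiplications only (\<open>R1\<close>,
  \<open>R2\<close>); each factor then moves across the Frobenius inner product as its
  transpose.\<close>

lemma residual_map_adjoint:
  assumes A: "A \<in> carrier_mat n n" and le: "block_start ns i + ns i \<le> n"
  shows "(\<Sum>p\<in>residual_entries n ns i. residual_map n ns A i u p * y p)
       = (\<Sum>s\<in>square_entries n. u s * residual_adjoint n ns A i y s)"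
proof -
  define Y where "Y = mat n n (u \<circ> Inl)"
  define X where "X = mat n n (u \<circ> Inr)"
  define T1 where "T1 = mat (ns i) n (y \<circ> Inl)"
  define T2 where "T2 = mat n (ns i) (y \<circ> Inr)"
  define B where "B = row_block ns i A"
  define E where "E = unit_col_block n ns i"
  note defs = Y_def X_def T1_def T2_def B_def E_def
  have c: "Y \<in> carrier_mat n n" "X \<in> carrier_mat n n" "T1 \<in> carrier_mat (ns i) n"
    "T2 \<in> carrier_mat n (ns i)" "B \<in> carrier_mat (ns i) n" "E \<in> carrier_mat n (ns i)"
    using A by (auto simp: defs row_block_def col_block_def)
  have R1: "row_residual ns A i X Y = transpose_mat E * Y - B * X"
    using c(1) le by (simp add: row_residual_def row_block_conv_mult[OF c(1) le] E_def B_def)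
  have "col_block ns i (0\<^sub>m n n) = (0\<^sub>m n (ns i) :: real mat)"
    using le by (intro eq_matI) (auto simp: col_block_def)
  then have R2: "col_residual n ns A (0\<^sub>m n n) i X Y = Y * transpose_mat B - X * E"
    using c minus_carrier_mat[OF mult_carrier_mat[OF c(2,6)], of "Y * transpose_mat B"]
    by (simp add: col_residual_def B_def[symmetric] E_def[symmetric])
  have "(\<Sum>p\<in>residual_entries n ns i. residual_map n ns A i u p * y p)
      = frob_inner (transpose_mat E * Y - B * X) T1 + frob_inner (Y * transpose_mat B - X * E) T2"
    using c by (simp add: residual_entries_def residual_map_def Let_def sum.Plus R1[symmetric]
        R2[symmetric] frob_inner_carrier[OF row_residual_carrier[OF A c(2)]]
        frob_inner_carrier[OF col_residual_carrier] X_def[symmetric] Y_def[symmetric]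
        sum_index_pairs) (simp add: T1_def T2_def)
  also have "\<dots> = frob_inner (transpose_mat E * Y) T1 - frob_inner (B * X) T1
      + (frob_inner (Y * transpose_mat B) T2 - frob_inner (X * E) T2)"
    using c by (simp add: frob_inner_diff_left[of _ "ns i" n] frob_inner_diff_left[of _ n "ns i"])
  also have "\<dots> = frob_inner Y (E * T1) - frob_inner X (transpose_mat B * T1)
      + (frob_inner Y (T2 * B) - frob_inner X (T2 * transpose_mat E))"
    using c by (simp add: frob_inner_mult_left[of _ "ns i" n _ n] frob_inner_mult_right[of _ n n _ "ns i"])
  also have "\<dots> = frob_inner Y (E * T1 + T2 * B)
      + frob_inner X (- (transpose_mat B * T1) - T2 * transpose_mat E)"
    using c by (simp add: frob_inner_add_right[of _ n n] frob_inner_diff_right[of _ n n]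
        frob_inner_uminus_right[of _ n n])
  also have "\<dots> = (\<Sum>s\<in>square_entries n. u s * residual_adjoint n ns A i y s)"
    by (simp add: square_entries_def residual_adjoint_def Let_def sum.Plus
        frob_inner_carrier[OF c(1)] frob_inner_carrier[OF c(2)] T1_def[symmetric] T2_def[symmetric]
        B_def[symmetric] E_def[symmetric] sum_index_pairs del: index_mult_mat(1))
      (simp add: X_def Y_def)
  finally show ?thesis .
qed

section \<open>Iterates of the distributed algorithm\<close>

lemma entries_iff [simp]:
  "Inl p \<in> square_entries n \<longleftrightarrow> p \<in> {..<n} \<times> {..<n}"
  "Inr p \<in> square_entries n \<longleftrightarrow> p \<in> {..<n} \<times> {..<n}"
  "Inl p \<in> residual_entries n ns i \<longleftrightarrow> p \<in> {..<ns i} \<times> {..<n}"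
  "Inr p \<in> residual_entries n ns i \<longleftrightarrow> p \<in> {..<n} \<times> {..<ns i}"
  by (auto simp: square_entries_def residual_entries_def)

text \<open>The inequality for \<open>\<xi>\<close> read entrywise: its left side is the squared
  norm of the adjoint at \<open>(T1, T2)\<close>. This supplies \<open>adj_bound\<close>.\<close>

lemma residual_adjoint_bound:
  assumes A: "A \<in> carrier_mat n n"
    and bound: "\<And>T1 T2. T1 \<in> carrier_mat (ns i) n \<Longrightarrow> T2 \<in> carrier_mat n (ns i) \<Longrightarrow>
        (frob_norm (- (transpose_mat (row_block ns i A) * T1)
                    - T2 * transpose_mat (unit_col_block n ns i)))\<^sup>2
        + (frob_norm (unit_col_block n ns i * T1 + T2 * row_block ns i A))\<^sup>2
        \<le> \<xi> * (frob_norm T1)\<^sup>2 + \<xi> * (frob_norm T2)\<^sup>2"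
  shows "(\<Sum>s\<in>square_entries n. (residual_adjoint n ns A i y s)\<^sup>2)
    \<le> \<xi> * (\<Sum>p\<in>residual_entries n ns i. (y p)\<^sup>2)"
proof -
  define T1 where "T1 = mat (ns i) n (y \<circ> Inl)"
  define T2 where "T2 = mat n (ns i) (y \<circ> Inr)"
  define GY where "GY = unit_col_block n ns i * T1 + T2 * row_block ns i A"
  define GX where "GX = - (transpose_mat (row_block ns i A) * T1)
    - T2 * transpose_mat (unit_col_block n ns i)"
  have T: "T1 \<in> carrier_mat (ns i) n" "T2 \<in> carrier_mat n (ns i)"
    by (simp_all add: T1_def T2_def)
  have G: "GY \<in> carrier_mat n n" "GX \<in> carrier_mat n n"
    using A T by (auto simp: GY_def GX_def row_block_def col_block_def)
  have "residual_adjoint n ns A i y = case_sum (($$) GY) (($$) GX)"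
    by (simp add: residual_adjoint_def GY_def GX_def T1_def T2_def Let_def)
  then have "(\<Sum>s\<in>square_entries n. (residual_adjoint n ns A i y s)\<^sup>2) = (frob_norm GX)\<^sup>2 + (frob_norm GY)\<^sup>2"
    by (simp add: square_entries_def sum.Plus frob_norm_sq_carrier[OF G(1)] frob_norm_sq_carrier[OF G(2)])
  also have "\<dots> \<le> \<xi> * (frob_norm T1)\<^sup>2 + \<xi> * (frob_norm T2)\<^sup>2"
    unfolding GX_def GY_def by (rule bound[OF T])
  also have "\<dots> = \<xi> * (\<Sum>p\<in>residual_entries n ns i. (y p)\<^sup>2)"
  proof -
    have "(frob_norm T1)\<^sup>2 = (\<Sum>p\<in>{..<ns i} \<times> {..<n}. (y (Inl p))\<^sup>2)"
      unfolding frob_norm_sq_carrier[OF T(1)] by (intro sum.cong refl) (auto simp: T1_def)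
    moreover have "(frob_norm T2)\<^sup>2 = (\<Sum>p\<in>{..<n} \<times> {..<ns i}. (y (Inr p))\<^sup>2)"
      unfolding frob_norm_sq_carrier[OF T(2)] by (intro sum.cong refl) (auto simp: T2_def)
    ultimately show ?thesis
      by (simp add: residual_entries_def sum.Plus distrib_left)
  qed
  finally show ?thesis .
qed

text \<open>Since the residuals vanish at \<open>(X0, Y0)\<close>, those at \<open>(X, Y)\<close>
  are linear in the difference. The gradients are therefore the adjoint applied to the linear
  residual of the error, without a constant term.\<close>

lemma residual_adjoint_residual:
  assumes A: "A \<in> carrier_mat n n" and Q: "Q \<in> carrier_mat n n"
    and X: "X \<in> carrier_mat n n" and Y: "Y \<in> carrier_mat n n"
    and X0: "X0 \<in> carrier_mat n n" and Y0: "Y0 \<in> carrier_mat n n"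
    and le: "block_start ns i + ns i \<le> n"
    and zero: "row_residual ns A i X0 Y0 = 0\<^sub>m (ns i) n" "col_residual n ns A Q i X0 Y0 = 0\<^sub>m n (ns i)"
    and u: "mat n n (u \<circ> Inl) = Y - Y0" "mat n n (u \<circ> Inr) = X - X0"
  shows "residual_adjoint n ns A i (residual_map n ns A i u)
    = case_sum (($$) (grad_Y n ns A Q i X Y)) (($$) (grad_X n ns A Q i X Y))"
proof -
  have XY: "X = X0 + (X - X0)" "Y = Y0 + (Y - Y0)"
    using X Y X0 Y0 by (auto intro!: eq_matI)
  have d: "X - X0 \<in> carrier_mat n n" "Y - Y0 \<in> carrier_mat n n"
    using X0 Y0 by (simp_all add: minus_carrier_mat)
  have "row_residual ns A i X Y = row_residual ns A i (X0 + (X - X0)) (Y0 + (Y - Y0))"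
    using XY by simp
  also have "\<dots> = row_residual ns A i (X - X0) (Y - Y0)"
    by (simp add: row_residual_add[OF A X0 Y0 d le] zero row_residual_carrier[OF A d(1)])
  finally have R: "row_residual ns A i X Y = row_residual ns A i (X - X0) (Y - Y0)" .
  have "col_residual n ns A Q i X Y = col_residual n ns A Q i (X0 + (X - X0)) (Y0 + (Y - Y0))"
    using XY by simp
  also have "\<dots> = col_residual n ns A (0\<^sub>m n n) i (X - X0) (Y - Y0)"
    by (simp add: col_residual_add[OF A Q X0 Y0 d le] zero col_residual_carrier)
  finally have C: "col_residual n ns A Q i X Y = col_residual n ns A (0\<^sub>m n n) i (X - X0) (Y - Y0)" .
  have "mat (ns i) n (residual_map n ns A i u \<circ> Inl) = row_residual ns A i X Y"
    unfolding R using row_residual_carrier[OF A d(1), of ns i "Y - Y0"]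
    by (intro eq_matI) (auto simp: residual_map_def u Let_def)
  moreover have "mat n (ns i) (residual_map n ns A i u \<circ> Inr) = col_residual n ns A Q i X Y"
    unfolding C using col_residual_carrier[OF zero_carrier_mat, of n ns A i "X - X0" "Y - Y0"]
    by (intro eq_matI) (auto simp: residual_map_def u Let_def)
  ultimately show ?thesis
    by (simp add: residual_adjoint_def grad_Y_def grad_X_def Let_def)
qed

section \<open>Frobenius norms of stacked matrices\<close>

lemma sum_lessThan_add:
  fixes f :: "nat \<Rightarrow> 'a :: comm_monoid_add"
  shows "(\<Sum>r<a + b. f r) = (\<Sum>r<a. f r) + (\<Sum>r<b. f (a + r))"
  by (induction b) (simp_all add: add.assoc)

lemma append_rows_carrier_index:
  assumes "A \<in> carrier_mat a n" "B \<in> carrier_mat b n" "r < a + b" "c < n"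
  shows "(A @\<^sub>r B) $$ (r, c) = (if r < a then A $$ (r, c) else B $$ (r - a, c))"
  using assms by (auto simp: append_rows_def)

lemma frob_norm_sq_append_rows_diff:
  assumes A: "A \<in> carrier_mat a n" "A' \<in> carrier_mat a n"
    and B: "B \<in> carrier_mat b n" "B' \<in> carrier_mat b n"
  shows "(frob_norm ((A @\<^sub>r B) - (A' @\<^sub>r B')))\<^sup>2 = (frob_norm (A - A'))\<^sup>2 + (frob_norm (B - B'))\<^sup>2"
proof -
  let ?f = "\<lambda>r. \<Sum>c<n. (((A @\<^sub>r B) - (A' @\<^sub>r B')) $$ (r, c))\<^sup>2"
  have car: "A @\<^sub>r B \<in> carrier_mat (a + b) n" "A' @\<^sub>r B' \<in> carrier_mat (a + b) n"
    using assms by auto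
  have entry: "((A @\<^sub>r B) - (A' @\<^sub>r B')) $$ (r, c)
      = (if r < a then A $$ (r, c) - A' $$ (r, c) else B $$ (r - a, c) - B' $$ (r - a, c))"
    if "r < a + b" "c < n" for r c
    using that append_rows_carrier_index[OF A(1) B(1) that] append_rows_carrier_index[OF A(2) B(2) that]
    by (simp add: carrier_matD[OF car(2)])
  have "(frob_norm ((A @\<^sub>r B) - (A' @\<^sub>r B')))\<^sup>2 = (\<Sum>r<a + b. ?f r)"
    by (simp add: frob_norm_sq carrier_matD[OF car(2)])
  also have "\<dots> = (\<Sum>r<a. ?f r) + (\<Sum>r<b. ?f (a + r))"
    by (rule sum_lessThan_add)
  also have "(\<Sum>r<a. ?f r) = (frob_norm (A - A'))\<^sup>2"
    using assms by (simp add: frob_norm_sq entry)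
  also have "(\<Sum>r<b. ?f (a + r)) = (frob_norm (B - B'))\<^sup>2"
    using assms by (simp add: frob_norm_sq entry)
  finally show ?thesis .
qed

lemma row_stack_carrier:
  assumes "\<And>i. i < m \<Longrightarrow> F i \<in> carrier_mat b n"
  shows "row_stack n F m \<in> carrier_mat (m * b) n"
  using assms
proof (induction m)
  case (Suc m)
  then have "row_stack n F m @\<^sub>r F m \<in> carrier_mat (m * b + b) n"
    by (intro carrier_append_rows) auto
  then show ?case by (simp add: add.commute)
qed simp

lemma frob_norm_sq_row_stack_diff:
  assumes "\<And>i. i < m \<Longrightarrow> F i \<in> carrier_mat b n" "\<And>i. i < m \<Longrightarrow> F' i \<in> carrier_mat b n"
  shows "(frob_norm (row_stack n F m - row_stack n F' m))\<^sup>2 = (\<Sum>i<m. (frob_norm (F i - F' i))\<^sup>2)"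
  using assms
proof (induction m)
  case 0
  then show ?case by (simp add: frob_norm_sq)
next
  case (Suc m)
  then show ?case
    using frob_norm_sq_append_rows_diff[of "row_stack n F m" "m * b" n "row_stack n F' m" "F m" b "F' m"]
    by (simp add: row_stack_carrier)
qed

lemma frob_norm_sq_stacked_diff:
  assumes "\<And>i. i < m \<Longrightarrow> X i \<in> carrier_mat n n \<and> Y i \<in> carrier_mat n n"
    "\<And>i. i < m \<Longrightarrow> X' i \<in> carrier_mat n n \<and> Y' i \<in> carrier_mat n n"
  shows "(frob_norm (stacked n m X Y - stacked n m X' Y'))\<^sup>2
    = (\<Sum>i<m. (frob_norm (Y i - Y' i))\<^sup>2 + (frob_norm (X i - X' i))\<^sup>2)"
proof -
  have "(frob_norm (stacked n m X Y - stacked n m X' Y'))\<^sup>2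
      = (\<Sum>i<m. (frob_norm ((Y i @\<^sub>r X i) - (Y' i @\<^sub>r X' i)))\<^sup>2)"
    unfolding stacked_def using assms by (intro frob_norm_sq_row_stack_diff[of _ _ "n + n"]) auto
  then show ?thesis
    using assms by (auto intro!: sum.cong frob_norm_sq_append_rows_diff[of _ n n _ _ n])
qed

lemma weighted_graph_consensus_weights:
  assumes G: "weighted_graph m G W" and W: "doubly_stochastic m W"
    and conn: "Digraph_Component.connected (with_proj G)"
  shows "consensus_weights m (\<lambda>i j. W $$ (i, j))"
  unfolding consensus_weights_def
proof (intro conjI allI impI)
  fix f :: "nat \<Rightarrow> real" and i j
  assume eq: "\<forall>i<m. \<forall>j<m. 0 < W $$ (i, j) \<longrightarrow> f i = f j" and ij: "i < m" "j < m"
  have verts: "pverts G = {..<m}" and "pair_graph G"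
    and pos: "\<And>i j. i < m \<Longrightarrow> j < m \<Longrightarrow> 0 < W $$ (i, j) \<longleftrightarrow> (i, j) \<in> parcs G"
    using G by (auto simp: weighted_graph_def)
  interpret pair_graph G by fact
  have arc: "f a = f b" if "(a, b) \<in> parcs G" for a b
  proof -
    have "a < m" "b < m" using that verts arc_fst_in_verts arc_snd_in_verts by auto
    then show ?thesis using that pos eq by auto
  qed
  \<comment> \<open>Connectedness is strong connectedness of the symmetric closure. Its arcs are
    arcs of \<open>G\<close> or their reversals, so \<open>arc\<close> carries the value of
    \<open>f\<close> along the path.\<close>
  have "i \<rightarrow>\<^sup>*\<^bsub>mk_symmetric (with_proj G)\<^esub> j"
    using conn ij verts unfolding connected_def strongly_connected_def by simp
  then show "f i = f j"
    unfolding reachable_def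
  proof (induction rule: rtrancl_on_induct)
    case (step x y)
    then show ?case using arc by (auto simp: parcs_mk_symmetric)
  qed simp
qed (use G W in \<open>auto simp: weighted_graph_def doubly_stochastic_def\<close>)

text \<open>Agents that are not neighbors have weight zero, so the sum extends to all agents and
  takes the Laplacian form of \<open>hess\<close>.\<close>

lemma disagreement_index:
  assumes G: "weighted_graph m G W" and X: "\<And>j. j < m \<Longrightarrow> X j \<in> carrier_mat n n"
    and i: "i < m" and rc: "r < n" "c < n"
  shows "disagreement n G W X i $$ (r, c) = (\<Sum>j<m. W $$ (i, j) * (X i $$ (r, c) - X j $$ (r, c)))"
proof -
  have verts: "pverts G = {..<m}" and "pair_graph G"
    and pos: "\<And>j. j < m \<Longrightarrow> 0 \<le> W $$ (i, j)" "\<And>j. j < m \<Longrightarrow> 0 < W $$ (i, j) \<longleftrightarrow> (i, j) \<in> parcs G"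
    using G i unfolding weighted_graph_def by blast+
  interpret pair_graph G by fact
  have sub: "neighbors G i \<subseteq> {..<m}"
    using verts arc_snd_in_verts by (auto simp: neighbors_def)
  have "disagreement n G W X i $$ (r, c) = (\<Sum>j\<in>neighbors G i. (W $$ (i, j) \<cdot>\<^sub>m (X i - X j)) $$ (r, c))"
    using rc by (simp add: disagreement_def mat_sum_def)
  also have "\<dots> = (\<Sum>j\<in>neighbors G i. W $$ (i, j) * (X i $$ (r, c) - X j $$ (r, c)))"
  proof (rule sum.cong[OF refl])
    fix j assume "j \<in> neighbors G i"
    then have "X j \<in> carrier_mat n n" using sub X by auto
    then show "(W $$ (i, j) \<cdot>\<^sub>m (X i - X j)) $$ (r, c) = W $$ (i, j) * (X i $$ (r, c) - X j $$ (r, c))"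
      using rc by auto
  qed
  also have "\<dots> = (\<Sum>j<m. W $$ (i, j) * (X i $$ (r, c) - X j $$ (r, c)))"
  proof (rule sum.mono_neutral_left[OF _ sub])
    show "\<forall>j\<in>{..<m} - neighbors G i. W $$ (i, j) * (X i $$ (r, c) - X j $$ (r, c)) = 0"
    proof
      fix j assume "j \<in> {..<m} - neighbors G i"
      then have "W $$ (i, j) = 0" using pos[of j] by (auto simp: neighbors_def)
      then show "W $$ (i, j) * (X i $$ (r, c) - X j $$ (r, c)) = 0" by simp
    qed
  qed simp
  finally show ?thesis .
qed

lemma grad_carrier:
  assumes "A \<in> carrier_mat n n" "Q \<in> carrier_mat n n"
  shows "grad_X n ns A Q i X Y \<in> carrier_mat n n" "grad_Y n ns A Q i X Y \<in> carrier_mat n n"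
  using assms(1) col_residual_carrier[OF assms(2), of ns A i X Y]
  by (auto simp: grad_X_def grad_Y_def row_block_def col_block_def)

text \<open>No induction is involved: a difference takes its dimensions from the subtrahend, here a
  multiple of a disagreement, which is square by construction.\<close>

lemma generated_carrier:
  assumes "generated n m ns A Q \<alpha> G W X Y" "i < m"
  shows "X k i \<in> carrier_mat n n \<and> Y k i \<in> carrier_mat n n"
proof (cases k)
  case 0
  then show ?thesis using assms by (simp add: generated_def)
next
  case (Suc k)
  then show ?thesis using assms
    by (auto simp: generated_def disagreement_def mat_sum_def intro!: minus_carrier_mat)
qed

text \<open>Costs are nonnegative, so a consensual point of cost zero is a minimizer.\<close>

lemma optimal_solution_of_zero_residuals:
  assumes X: "X \<in> carrier_mat n n" and Y: "Y \<in> carrier_mat n n"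
    and zero: "\<And>i. i < m \<Longrightarrow> row_residual ns A i X Y = 0\<^sub>m (ns i) n"
      "\<And>i. i < m \<Longrightarrow> col_residual n ns A Q i X Y = 0\<^sub>m n (ns i)"
  shows "optimal_solution n m ns A Q (stacked n m (\<lambda>_. X) (\<lambda>_. Y))"
  unfolding optimal_solution_def
proof (intro exI conjI allI impI)
  show "feasible n m (\<lambda>_. X) (\<lambda>_. Y)" using X Y by (simp add: feasible_def)
  fix X' Y'
  have "total_cost n m ns A Q (\<lambda>_. X) (\<lambda>_. Y) = 0"
    by (simp add: total_cost_def local_cost_def zero)
  also have "0 \<le> total_cost n m ns A Q X' Y'"
    by (simp add: total_cost_def local_cost_def sum_nonneg)
  finally show "total_cost n m ns A Q (\<lambda>_. X) (\<lambda>_. Y) \<le> total_cost n m ns A Q X' Y'" .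
qed simp

section \<open>The abstract network applied to the Lyapunov residuals\<close>

theorem theorem2:
  fixes n m :: nat and ns :: "nat \<Rightarrow> nat"
    and A Q :: "real mat"
    and \<alpha> \<xi> :: "nat \<Rightarrow> real"
    and G :: "nat \<Rightarrow> nat pair_pre_digraph" and W :: "nat \<Rightarrow> real mat"
    and X Y :: "nat \<Rightarrow> nat \<Rightarrow> real mat"
  assumes agents: "0 < m"
    and blocks: "\<And>i. i < m \<Longrightarrow> 0 < ns i" "(\<Sum>i<m. ns i) = n"
    and A: "A \<in> carrier_mat n n"
    and Q: "Q \<in> carrier_mat n n" "transpose_mat Q = Q"
    and solvable: "\<exists>S \<in> carrier_mat n n. A * S * transpose_mat A - S + Q = 0\<^sub>m n n"
    and graphs: "\<And>k. weighted_graph m (G k) (W k)" "\<And>k. doubly_stochastic m (W k)"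
    and step: "\<And>i. i < m \<Longrightarrow> 0 < \<alpha> i \<and> \<alpha> i < min 1 (1 / \<xi> i)"
    and xi: "\<And>i T1 T2. i < m \<Longrightarrow> T1 \<in> carrier_mat (ns i) n \<Longrightarrow> T2 \<in> carrier_mat n (ns i) \<Longrightarrow>
        (frob_norm (- (transpose_mat (row_block ns i A) * T1)
                    - T2 * transpose_mat (unit_col_block n ns i)))\<^sup>2
        + (frob_norm (unit_col_block n ns i * T1 + T2 * row_block ns i A))\<^sup>2
        \<le> \<xi> i * (frob_norm T1)\<^sup>2 + \<xi> i * (frob_norm T2)\<^sup>2"
    and finitely_many: "finite (range (\<lambda>k. (G k, W k)))"
    and conn: "\<And>k. Digraph_Component.connected (with_proj (G k))"
    and iterates: "generated n m ns A Q \<alpha> G W X Y"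
  shows "\<exists>Z. optimal_solution n m ns A Q Z \<and>
           (\<exists>C \<rho>. 0 \<le> C \<and> 0 < \<rho> \<and> \<rho> < 1 \<and>
              (\<forall>k. frob_norm (stacked n m (X k) (Y k) - Z) \<le> C * \<rho> ^ k))"
proof -
  note le = block_bound[OF _ blocks(2)]
  obtain X0 where X0: "X0 \<in> carrier_mat n n" and sol: "A * X0 * transpose_mat A - X0 + Q = 0\<^sub>m n n"
    using solvable by blast
  \<comment> \<open>The second variable stands for \<open>A * X\<close>; with this choice a Lyapunov
    solution is a common zero of all residuals.\<close>
  define Y0 where "Y0 = A * X0"
  have Y0: "Y0 \<in> carrier_mat n n" using A X0 by (simp add: Y0_def)
  have zero: "row_residual ns A i X0 Y0 = 0\<^sub>m (ns i) n" "col_residual n ns A Q i X0 Y0 = 0\<^sub>m n (ns i)"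
    if "i < m" for i
    unfolding Y0_def using row_residual_lyapunov_solution[OF A X0 le[OF that]]
      col_residual_lyapunov_solution[OF A X0 Q(1) le[OF that] sol] by simp_all
  note XY = generated_carrier[OF iterates]
  have \<xi>: "\<alpha> i * \<xi> i < 1" if "i < m" for i
  proof -
    \<comment> \<open>A positive step size below \<open>1 / \<xi> i\<close> forces
      \<open>\<xi> i\<close> to be positive, so the denominator can be cleared; this also excludes
      the default \<open>1 / 0 = 0\<close>.\<close>
    have "0 < 1 / \<xi> i" using step[OF that] by linarith
    then have "0 < \<xi> i" by simp
    then show ?thesis using step[OF that] by (simp add: field_simps)
  qed
  interpret agent_network m "square_entries n" "residual_entries n ns" "residual_map n ns A"
    "residual_adjoint n ns A" \<alpha> \<xi>
  proof
    show "(\<Sum>s\<in>square_entries n. (residual_adjoint n ns A i y s)\<^sup>2)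
        \<le> \<xi> i * (\<Sum>p\<in>residual_entries n ns i. (y p)\<^sup>2)" if "i < m" for i y
      using xi[OF that] by (rule residual_adjoint_bound[OF A])
  qed (use step \<xi> residual_map_adjoint[OF A le] in \<open>auto simp: finite_entries\<close>)
  define w where "w = (\<lambda>k i j. W k $$ (i, j))"
  define e where "e = (\<lambda>k (i, s). case s of Inl p \<Rightarrow> Y k i $$ p - Y0 $$ p | Inr p \<Rightarrow> X k i $$ p - X0 $$ p)"
  have e_simps: "e k (i, Inl p) = Y k i $$ p - Y0 $$ p" "e k (i, Inr p) = X k i $$ p - X0 $$ p" for k i p
    by (simp_all add: e_def)
  have w: "consensus_weights m (w k)" for k
    unfolding w_def by (rule weighted_graph_consensus_weights[OF graphs conn])
  have "range w = (\<lambda>V i j. V $$ (i, j)) ` snd ` range (\<lambda>k. (G k, W k))"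
    by (simp add: w_def image_image)
  then have fin: "finite (range w)"
    using finitely_many by simp
  have e_step: "e (Suc k) (i, s) = e k (i, s) - \<alpha> i * hess (w k) (e k) (i, s)"
    if i: "i < m" and s: "s \<in> square_entries n" for k i s
  proof -
    have "mat n n (local_state (e k) i \<circ> Inl) = Y k i - Y0" "mat n n (local_state (e k) i \<circ> Inr) = X k i - X0"
      using XY[OF i, of k] X0 Y0 by (auto simp: e_simps intro!: eq_matI)
    from residual_adjoint_residual[OF A Q(1) _ _ X0 Y0 le[OF i] zero[OF i] this]
    have grad: "residual_adjoint n ns A i (residual_map n ns A i (local_state (e k) i))
        = case_sum (($$) (grad_Y n ns A Q i (X k i) (Y k i))) (($$) (grad_X n ns A Q i (X k i) (Y k i)))"
      using XY[OF i, of k] by simp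
    have iter: "X (Suc k) i = X k i - \<alpha> i \<cdot>\<^sub>m grad_X n ns A Q i (X k i) (Y k i)
          - (\<alpha> i / 2) \<cdot>\<^sub>m disagreement n (G k) (W k) (X k) i"
        "Y (Suc k) i = Y k i - \<alpha> i \<cdot>\<^sub>m grad_Y n ns A Q i (X k i) (Y k i)
          - (\<alpha> i / 2) \<cdot>\<^sub>m disagreement n (G k) (W k) (Y k) i"
      using iterates i by (auto simp: generated_def)
    have dis: "disagreement n (G k) (W k) V i \<in> carrier_mat n n" for V
      by (simp add: disagreement_def mat_sum_def)
    note car = grad_carrier[OF A Q(1), of ns i "X k i" "Y k i"] dis[of "X k"] dis[of "Y k"]
    have disX: "disagreement n (G k) (W k) (X k) i $$ (r, c)
          = (\<Sum>j<m. w k i j * (X k i $$ (r, c) - X k j $$ (r, c)))"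
      and disY: "disagreement n (G k) (W k) (Y k) i $$ (r, c)
          = (\<Sum>j<m. w k i j * (Y k i $$ (r, c) - Y k j $$ (r, c)))"
      if "r < n" "c < n" for r c
      using disagreement_index[OF graphs(1) _ i that] XY by (auto simp: w_def)
    \<comment> \<open>All agents are compared with the same \<open>(X0, Y0)\<close>, which therefore
      cancels in the disagreement of the errors.\<close>
    have hess: "hess (w k) (e k) (i, s)
        = case_sum (($$) (grad_Y n ns A Q i (X k i) (Y k i))) (($$) (grad_X n ns A Q i (X k i) (Y k i))) s
          + 1/2 * (\<Sum>j<m. w k i j * (e k (i, s) - e k (j, s)))"
      by (simp add: hess_def grad)
    from s consider r c where "s = Inl (r, c)" "r < n" "c < n"
      | r c where "s = Inr (r, c)" "r < n" "c < n"
      by (auto simp: square_entries_def)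
    then show ?thesis
    proof cases
      case 1
      then show ?thesis unfolding hess using car XY[OF i, of k]
        by (simp add: iter disY e_simps) (simp add: algebra_simps)
    next
      case 2
      then show ?thesis unfolding hess using car XY[OF i, of k]
        by (simp add: iter disX e_simps) (simp add: algebra_simps)
    qed
  qed
  obtain u C \<rho> where u: "solution u" and C: "0 \<le> C" and \<rho>: "0 < \<rho>" "\<rho> < 1"
    and conv: "\<And>k. (\<Sum>i<m. \<Sum>s\<in>square_entries n. (e k (i, s) - u (i, s))\<^sup>2) \<le> C * \<rho> ^ k"
    using linear_convergence[of w e, OF w fin e_step] by blast
  \<comment> \<open>All agents agree in \<open>u\<close>, so agent 0, present because
    \<open>0 < m\<close>, represents the limit.\<close>
  define UY where "UY = mat n n (local_state u 0 \<circ> Inl)"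
  define UX where "UX = mat n n (local_state u 0 \<circ> Inr)"
  have U: "UX \<in> carrier_mat n n" "UY \<in> carrier_mat n n" by (simp_all add: UX_def UY_def)
  have u0: "u (i, s) = u (0, s)" if "i < m" "s \<in> square_entries n" for i s
    using u agents that unfolding solution_def by blast
  have res0: "row_residual ns A i UX UY = 0\<^sub>m (ns i) n" "col_residual n ns A (0\<^sub>m n n) i UX UY = 0\<^sub>m n (ns i)"
    if i: "i < m" for i
  proof -
    have "mat n n (local_state u i \<circ> Inl) = UY" "mat n n (local_state u i \<circ> Inr) = UX"
      using u0[OF i] by (auto simp: UX_def UY_def intro!: eq_matI)
    then have map: "residual_map n ns A i (local_state u i)
        = case_sum (($$) (row_residual ns A i UX UY)) (($$) (col_residual n ns A (0\<^sub>m n n) i UX UY))"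
      by (simp add: residual_map_def)
    have res: "residual_map n ns A i (local_state u i) p = 0" if "p \<in> residual_entries n ns i" for p
      using u i that unfolding solution_def by blast
    have *: "row_residual ns A i UX UY $$ (r, c) = 0" if "r < ns i" "c < n" for r c
      using res[of "Inl (r, c)"] that unfolding map by simp
    have **: "col_residual n ns A (0\<^sub>m n n) i UX UY $$ (r, c) = 0" if "r < n" "c < ns i" for r c
      using res[of "Inr (r, c)"] that unfolding map by simp
    show "row_residual ns A i UX UY = 0\<^sub>m (ns i) n"
      using * row_residual_carrier[OF A U(1), of ns i UY] by (intro eq_matI) auto
    show "col_residual n ns A (0\<^sub>m n n) i UX UY = 0\<^sub>m n (ns i)"
      using ** col_residual_carrier[OF zero_carrier_mat, of n ns A i UX UY] by (intro eq_matI) auto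
  qed
  \<comment> \<open>Undoes the shift: a zero of the residuals plus a zero of their linear parts is
    again a zero of the residuals.\<close>
  define Xs where "Xs = X0 + UX"
  define Ys where "Ys = Y0 + UY"
  have s: "Xs \<in> carrier_mat n n" "Ys \<in> carrier_mat n n"
    using X0 Y0 U by (simp_all add: Xs_def Ys_def)
  have "optimal_solution n m ns A Q (stacked n m (\<lambda>_. Xs) (\<lambda>_. Ys))"
  proof (rule optimal_solution_of_zero_residuals[OF s])
    fix i assume i: "i < m"
    show "row_residual ns A i Xs Ys = 0\<^sub>m (ns i) n"
      by (simp add: Xs_def Ys_def row_residual_add[OF A X0 Y0 U le[OF i]] zero[OF i] res0[OF i])
    show "col_residual n ns A Q i Xs Ys = 0\<^sub>m n (ns i)"
      by (simp add: Xs_def Ys_def col_residual_add[OF A Q(1) X0 Y0 U le[OF i]] zero[OF i] res0[OF i])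
  qed
  \<comment> \<open>\<open>conv\<close> bounds the squared norm, so the constant and the rate are
    square roots.\<close>
  moreover have "frob_norm (stacked n m (X k) (Y k) - stacked n m (\<lambda>_. Xs) (\<lambda>_. Ys)) \<le> sqrt C * sqrt \<rho> ^ k" for k
  proof -
    have "(frob_norm (stacked n m (X k) (Y k) - stacked n m (\<lambda>_. Xs) (\<lambda>_. Ys)))\<^sup>2
        = (\<Sum>i<m. (frob_norm (Y k i - Ys))\<^sup>2 + (frob_norm (X k i - Xs))\<^sup>2)"
      using XY s by (intro frob_norm_sq_stacked_diff) auto
    also have "\<dots> = (\<Sum>i<m. \<Sum>s\<in>square_entries n. (e k (i, s) - u (i, s))\<^sup>2)"
    proof (rule sum.cong[OF refl])
      fix i assume "i \<in> {..<m}"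
      then have i: "i < m" by simp
      have "(frob_norm (Y k i - Ys))\<^sup>2 = (\<Sum>p\<in>{..<n} \<times> {..<n}. (e k (i, Inl p) - u (i, Inl p))\<^sup>2)"
        unfolding frob_norm_sq_carrier[OF minus_carrier_mat[OF s(2)]]
      proof (intro sum.cong refl)
        fix p assume p: "p \<in> {..<n} \<times> {..<n}"
        then have "u (i, Inl p) = u (0, Inl p)" by (intro u0[OF i]) auto
        then show "((Y k i - Ys) $$ p)\<^sup>2 = (e k (i, Inl p) - u (i, Inl p))\<^sup>2"
          using p XY[OF i, of k] Y0 U by (auto simp: Ys_def UY_def e_simps algebra_simps)
      qed
      moreover have "(frob_norm (X k i - Xs))\<^sup>2 = (\<Sum>p\<in>{..<n} \<times> {..<n}. (e k (i, Inr p) - u (i, Inr p))\<^sup>2)"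
        unfolding frob_norm_sq_carrier[OF minus_carrier_mat[OF s(1)]]
      proof (intro sum.cong refl)
        fix p assume p: "p \<in> {..<n} \<times> {..<n}"
        then have "u (i, Inr p) = u (0, Inr p)" by (intro u0[OF i]) auto
        then show "((X k i - Xs) $$ p)\<^sup>2 = (e k (i, Inr p) - u (i, Inr p))\<^sup>2"
          using p XY[OF i, of k] X0 U by (auto simp: Xs_def UX_def e_simps algebra_simps)
      qed
      ultimately show "(frob_norm (Y k i - Ys))\<^sup>2 + (frob_norm (X k i - Xs))\<^sup>2
          = (\<Sum>s\<in>square_entries n. (e k (i, s) - u (i, s))\<^sup>2)"
        by (simp add: square_entries_def sum.Plus)
    qed
    also have "\<dots> \<le> C * \<rho> ^ k" by (rule conv)
    also have "\<dots> = (sqrt C * sqrt \<rho> ^ k)\<^sup>2"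
    proof -
      have "(sqrt \<rho> ^ k)\<^sup>2 = ((sqrt \<rho>)\<^sup>2) ^ k"
        by (simp only: power_mult[symmetric] mult.commute)
      then show ?thesis using C \<rho> by (simp add: power_mult_distrib)
    qed
    finally show ?thesis
      by (rule power2_le_imp_le) (use C \<rho> in simp)
  qed
  moreover have "0 \<le> sqrt C \<and> 0 < sqrt \<rho> \<and> sqrt \<rho> < 1" using C \<rho> by simp
  ultimately show ?thesis by metis
qed

end
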